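(* Let $A$ be a $C^*$-algebra, let $E\subseteq A$ be a closed $*$-subspace, and let $\mathcal{E}\subseteq\mathcal{A}$ be $*$-subspaces with $\mathcal{E}\subseteq E$ dense in $E$ and $\mathcal{A}\subseteq A$ dense in $A$. Suppose there exists a norm-defining approximate order unit for $\mathcal{A}$ which is contained in $\mathcal{E}$. Then for every $n\geq 1$ and every hermitian continuous linear functional $\phi:M_n(E)\to\mathbb{C}$ there exist positive linear functionals $\phi_+,\phi_-:M_n(E)\to\mathbb{C}$ such that $\phi=\phi_+-\phi_-$ and $\|\phi\|=\|\phi_+\|+\|\phi_-\|$.
   Context: A $*$-subspace is a linear subspace closed under the involution. For a $*$-subspace $V\subseteq A$ of a $C^*$-algebra, $M_n(V)$ carries the norm, involution and order inherited from the $C^*$-algebra $M_n(A)$: $M_n(V)_h$ is the set of self-adjoint elements and $M_n(V)_+=M_n(V)\cap M_n(A)_+$. For $e\in V$ write $e^n=\mathrm{diag}(e,\dots,e)\in M_n(V)$. An approximate order unit for $V$ is a net $\{e_\lambda\}_{\lambda\in\Lambda}$ with $e_\lambda\in V_+$ for all $\lambda$; $e_\lambda\leq e_\mu$ whenever $\lambda\leq\mu$; and for each $x\in V_h$ there are a real $t>0$ and $\lambda\in\Lambda$ with $-te_\lambda\leq x\leq te_\lambda$. It is norm-defining if for every $n$ and every $x\in M_n(V)$, $$\|x\|=\inf\left\{t:\begin{pmatrix}te_\lambda^n & x \\ x^* & te_\lambda^n\end{pmatrix}\in M_{2n}(V)_+\text{ for some }\lambda\in\Lambda\right\}.$$ A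 linear functional $\phi$ on $M_n(E)$ is hermitian if $\phi(x^* )=\overline{\phi(x)}$ for all $x$, and positive if $\phi(x)\geq0$ for all $x\in M_n(E)_+$. Norms of functionals are the Banach space dual norms. *)

theory Defs
  imports "HOL-Analysis.Analysis" "Jordan_Normal_Form.Matrix"
begin

text \<open>
  Complex \<open>C\<^sup>*\<close>-algebras, not assumed unital (and possibly zero).  The real scalar multiplication
  and the norm are those of the Banach algebra structure; \<open>cscale\<close> extends the former.
\<close>

class cstar_algebra = real_normed_algebra + banach +
  fixes cscale :: "complex \<Rightarrow> 'a \<Rightarrow> 'a"
    and star :: "'a \<Rightarrow> 'a"
  assumes cscale_add_right: "cscale c (x + y) = cscale c x + cscale c y"
    and cscale_add_left: "cscale (c + d) x = cscale c x + cscale d x"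
    and cscale_cscale: "cscale c (cscale d x) = cscale (c * d) x"
    and cscale_of_real: "cscale (complex_of_real r) x = r *\<^sub>R x"
    and cscale_mult_left: "cscale c x * y = cscale c (x * y)"
    and cscale_mult_right: "x * cscale c y = cscale c (x * y)"
    and norm_cscale: "norm (cscale c x) = cmod c * norm x"
    and star_star: "star (star x) = x"
    and star_add: "star (x + y) = star x + star y"
    and star_cscale: "star (cscale c x) = cscale (cnj c) (star x)"
    and star_mult: "star (x * y) = star y * star x"
    and cstar_identity: "norm (star x * x) = (norm x)\<^sup>2"

definition positive :: "'a::cstar_algebra \<Rightarrow> bool" where
  "positive a \<longleftrightarrow> (\<exists>b. a = star b * b)"

definition cle :: "'a::cstar_algebra \<Rightarrow> 'a \<Rightarrow> bool" where
  "cle a b \<longleftrightarrow> positive (b - a)"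

definition star_subspace :: "'a::cstar_algebra set \<Rightarrow> bool" where
  "star_subspace V \<longleftrightarrow> 0 \<in> V \<and> (\<forall>x\<in>V. \<forall>y\<in>V. x + y \<in> V) \<and>
     (\<forall>c. \<forall>x\<in>V. cscale c x \<in> V) \<and> (\<forall>x\<in>V. star x \<in> V)"

definition mats :: "nat \<Rightarrow> 'a set \<Rightarrow> 'a mat set" where
  "mats n V = {x \<in> carrier_mat n n. \<forall>i<n. \<forall>j<n. x $$ (i, j) \<in> V}"

definition mat_cscale :: "complex \<Rightarrow> 'a::cstar_algebra mat \<Rightarrow> 'a mat" where
  "mat_cscale c x = map_mat (cscale c) x"

definition mat_star :: "'a::cstar_algebra mat \<Rightarrow> 'a mat" where
  "mat_star x = map_mat star (transpose_mat x)"

text \<open>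
  \<open>N\<close> is a norm turning the \<open>*\<close>-algebra of \<open>n \<times> n\<close> matrices over \<open>'a\<close> into a \<open>C\<^sup>*\<close>-algebra.
\<close>

definition mat_cstar_norm :: "nat \<Rightarrow> ('a::cstar_algebra mat \<Rightarrow> real) \<Rightarrow> bool" where
  "mat_cstar_norm n N \<longleftrightarrow>
     (\<forall>x\<in>carrier_mat n n. 0 \<le> N x \<and> (N x = 0 \<longleftrightarrow> x = 0\<^sub>m n n)) \<and>
     (\<forall>x\<in>carrier_mat n n. \<forall>y\<in>carrier_mat n n. N (x + y) \<le> N x + N y) \<and>
     (\<forall>c. \<forall>x\<in>carrier_mat n n. N (mat_cscale c x) = cmod c * N x) \<and>
     (\<forall>x\<in>carrier_mat n n. \<forall>y\<in>carrier_mat n n. N (x * y) \<le> N x * N y) \<and>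
     (\<forall>x\<in>carrier_mat n n. N (mat_star x * x) = (N x)\<^sup>2) \<and>
     (\<forall>X. (\<forall>k. X k \<in> carrier_mat n n) \<longrightarrow>
        (\<forall>\<epsilon>>0. \<exists>K. \<forall>k\<ge>K. \<forall>l\<ge>K. N (X k - X l) < \<epsilon>) \<longrightarrow>
        (\<exists>x\<in>carrier_mat n n. (\<lambda>k. N (X k - x)) \<longlonglongrightarrow> 0))"

text \<open>
  The norm of the \<open>C\<^sup>*\<close>-algebra of \<open>n \<times> n\<close> matrices: a \<open>C\<^sup>*\<close>-norm on it exists and is
  unique, so its value at a matrix in the carrier is well defined.
\<close>

definition mat_norm :: "nat \<Rightarrow> 'a::cstar_algebra mat \<Rightarrow> real" where
  "mat_norm n x = (THE r. \<exists>N. mat_cstar_norm n N \<and> r = N x)"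

definition mats_pos :: "nat \<Rightarrow> 'a::cstar_algebra set \<Rightarrow> 'a mat set" where
  "mats_pos n V = {x \<in> mats n V. \<exists>y\<in>carrier_mat n n. x = mat_star y * y}"

definition diag_const :: "nat \<Rightarrow> 'a::zero \<Rightarrow> 'a mat" where
  "diag_const n e = mat n n (\<lambda>(i, j). if i = j then e else 0)"

definition directed_index :: "'l set \<Rightarrow> ('l \<Rightarrow> 'l \<Rightarrow> bool) \<Rightarrow> bool" where
  "directed_index L lle \<longleftrightarrow> L \<noteq> {} \<and> reflp_on L lle \<and> transp_on L lle \<and>
     (\<forall>l\<in>L. \<forall>m\<in>L. \<exists>k\<in>L. lle l k \<and> lle m k)"

definition approx_order_unit ::
  "'a::cstar_algebra set \<Rightarrow> 'l set \<Rightarrow> ('l \<Rightarrow> 'l \<Rightarrow> bool) \<Rightarrow> ('l \<Rightarrow> 'a) \<Rightarrow> bool" where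
  "approx_order_unit V L lle e \<longleftrightarrow> directed_index L lle \<and>
     (\<forall>l\<in>L. e l \<in> V \<and> positive (e l)) \<and>
     (\<forall>l\<in>L. \<forall>m\<in>L. lle l m \<longrightarrow> cle (e l) (e m)) \<and>
     (\<forall>x\<in>V. star x = x \<longrightarrow>
        (\<exists>t>0. \<exists>l\<in>L. cle (- (t *\<^sub>R e l)) x \<and> cle x (t *\<^sub>R e l)))"

text \<open>
  The infimum is taken in the extended reals, so the infimum of the empty set is \<open>\<infinity>\<close>.  The
  parameter \<open>t\<close> is positive: this only matters if \<open>e l = 0\<close> for some \<open>l\<close>, in which case
  admitting negative \<open>t\<close> would make the infimum for \<open>x = 0\<close> equal to \<open>- \<infinity>\<close>.
\<close>

definition norm_defining ::
  "'a::cstar_algebra set \<Rightarrow> 'l set \<Rightarrow> ('l \<Rightarrow> 'a) \<Rightarrow> bool" where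
  "norm_defining V L e \<longleftrightarrow> (\<forall>n\<ge>1. \<forall>x\<in>mats n V.
     ereal (mat_norm n x) =
       (INF t\<in>{t. 0 < t \<and> (\<exists>l\<in>L. four_block_mat (diag_const n (t *\<^sub>R e l)) x
                                    (mat_star x) (diag_const n (t *\<^sub>R e l))
                                  \<in> mats_pos (2 * n) V)}. ereal t))"

text \<open>
  A functional on \<open>mats n E\<close> is a function on all matrices, of which only the values on
  \<open>mats n E\<close> are relevant.
\<close>

definition mats_linear :: "nat \<Rightarrow> 'a::cstar_algebra set \<Rightarrow> ('a mat \<Rightarrow> complex) \<Rightarrow> bool" where
  "mats_linear n E \<phi> \<longleftrightarrow>
     (\<forall>x\<in>mats n E. \<forall>y\<in>mats n E. \<phi> (x + y) = \<phi> x + \<phi> y) \<and>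
     (\<forall>c. \<forall>x\<in>mats n E. \<phi> (mat_cscale c x) = c * \<phi> x)"

definition mats_continuous :: "nat \<Rightarrow> 'a::cstar_algebra set \<Rightarrow> ('a mat \<Rightarrow> complex) \<Rightarrow> bool" where
  "mats_continuous n E \<phi> \<longleftrightarrow>
     (\<forall>x\<in>mats n E. \<forall>\<epsilon>>0. \<exists>\<delta>>0. \<forall>y\<in>mats n E.
        mat_norm n (y - x) < \<delta> \<longrightarrow> cmod (\<phi> y - \<phi> x) < \<epsilon>)"

definition mats_hermitian :: "nat \<Rightarrow> 'a::cstar_algebra set \<Rightarrow> ('a mat \<Rightarrow> complex) \<Rightarrow> bool" where
  "mats_hermitian n E \<phi> \<longleftrightarrow> (\<forall>x\<in>mats n E. \<phi> (mat_star x) = cnj (\<phi> x))"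

definition mats_positive :: "nat \<Rightarrow> 'a::cstar_algebra set \<Rightarrow> ('a mat \<Rightarrow> complex) \<Rightarrow> bool" where
  "mats_positive n E \<phi> \<longleftrightarrow> (\<forall>x\<in>mats_pos n E. \<phi> x \<in> \<real>\<^sub>\<ge>\<^sub>0)"

text \<open>Extended-real valued, hence meaningful (equal to \<open>\<infinity>\<close>) for unbounded functionals too.\<close>

definition dual_norm :: "nat \<Rightarrow> 'a::cstar_algebra set \<Rightarrow> ('a mat \<Rightarrow> complex) \<Rightarrow> ereal" where
  "dual_norm n E \<phi> = (SUP x\<in>{x \<in> mats n E. mat_norm n x \<le> 1}. ereal (cmod (\<phi> x)))"

end

theory Submission
  imports Defs
begin

text \<open>
  Fix a C*-norm on $M_n(A)$ and let $D = \|\phi\|$.  The decomposition of $\phi$ is a Hahn-Banach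
  extension.  On pairs of elements of the C*-algebra consider
    $q(a, b) = \inf \{\max (\|a + c\|, \|b + d\|) : c, d \ge 0\}$.
  A real-linear functional $F \le D q$ splits as $F(a, b) = g_1(a) + g_2(b)$; since $q \le 0$ at
  $(-c, 0)$ and $(0, -c)$ for $c \ge 0$, both $g_1$ and $g_2$ are positive, and since $q(a, b)$ is at
  most $\max (\|a\|, \|b\|)$, the sum of their norms is at most $D$.  So it suffices to dominate
  the functional $(x, -x) \mapsto \phi(x)$, defined for self-adjoint $x \in M_n(E)$, by $D q$, and to
  extend it: then $\phi = g_1 - g_2$ on self-adjoint elements (\<open>jordan_decomposition_star_subspace\<close>).

  The domination is the inequality $\|x\| \le \max (\|x + c\|, \|x - d\|)$ for self-adjoint $x$
  and positive $c, d$ (\<open>norm_le_of_order_bounds\<close>).  It holds because $r - x \ge 0$ and $r + x \ge 0$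
  imply $\|x\| \le r$.  Here positivity has to include every $y^* y$, the only positivity
  that the statement speaks of; this is the theorem of Kelley and Vaught (\<open>pos_star_mult_self\<close>).  All of this is done
  without spectrum or functional calculus.  Two facts replace them: $1 - w$ has a square root when
  $\|w\| < 1$ (a contraction argument), and commuting self-adjoint $h, k$ with
  $h^2 + k^2 = r^2$ have norm at most $r$, because $h + i k$ is $r$ times a unitary.

  Since positivity needs a unit, a C*-algebra is embedded into its multiplier algebra.  To have
  the matrix algebras available as a type, all pairs of a size $n$ and a C*-norm on $M_n(A)$ are
  collected into one C*-algebra of bounded families.  This also gives the uniqueness of the norm
  (\<open>mat_norm_eq\<close>): that a self-adjoint $x$ has norm less than 1 yields an equation
  $2 m = x^2 + m^2$, and such an equation bounds every C*-norm of $x$ by 1.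

  All of this starts from a C*-norm on $M_n(A)$.  If there were none, \<open>mat_norm n\<close> would be a constant function; as the norm-defining order unit gives the zero
  matrix the norm 0, the constant would be 0, continuity would make $\phi$ vanish, and there
  would be nothing to decompose.
\<close>

section \<open>Involution and scalars\<close>

lemma star_zero [simp]: "star (0::'a::cstar_algebra) = 0"
  by (metis add_cancel_right_right star_add)

lemma star_minus [simp]: "star (- x) = - star (x::'a::cstar_algebra)"
  by (metis add_eq_0_iff star_add star_zero)

lemma star_diff: "star (x - y) = star x - star (y::'a::cstar_algebra)"
  by (metis diff_conv_add_uminus star_add star_minus)

lemma star_scaleR [simp]: "star (r *\<^sub>R x) = r *\<^sub>R star (x::'a::cstar_algebra)"
  using star_cscale[of "complex_of_real r" x] by (simp add: cscale_of_real)

lemma cscale_zero [simp]: "cscale c (0::'a::cstar_algebra) = 0"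
  by (metis add_cancel_right_right cscale_add_right)

lemma cscale_minus: "cscale c (- x) = - cscale c (x::'a::cstar_algebra)"
  by (metis add_eq_0_iff cscale_add_right cscale_zero)

lemma cscale_diff: "cscale c (x - y) = cscale c x - cscale c (y::'a::cstar_algebra)"
  by (metis diff_conv_add_uminus cscale_add_right cscale_minus)

lemma cscale_zero_left [simp]: "cscale 0 (x::'a::cstar_algebra) = 0"
  using cscale_of_real[of 0 x] by simp

lemma cscale_one [simp]: "cscale 1 (x::'a::cstar_algebra) = x"
  using cscale_of_real[of 1 x] by simp

lemma cscale_minus_left: "cscale (- c) x = - cscale c (x::'a::cstar_algebra)"
  by (metis add_eq_0_iff cscale_add_left cscale_zero_left)

lemma cscale_scaleR: "cscale c (r *\<^sub>R x) = r *\<^sub>R cscale c (x::'a::cstar_algebra)"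
  by (simp flip: cscale_of_real add: cscale_cscale mult.commute)

lemma norm_star [simp]: "norm (star x) = norm (x::'a::cstar_algebra)"
proof -
  have le: "norm x \<le> norm (star x)" for x :: 'a
  proof (cases "x = 0")
    case True
    then show ?thesis by simp
  next
    case False
    have "norm x * norm x \<le> norm (star x) * norm x"
      using norm_mult_ineq[of "star x" x] by (simp add: cstar_identity power2_eq_square)
    with False show ?thesis by simp
  qed
  show ?thesis using le[of x] le[of "star x"] by (simp add: star_star)
qed

lemma bounded_linear_star: "bounded_linear (star :: 'a::cstar_algebra \<Rightarrow> 'a)"
  by (rule bounded_linear_intro[where K=1]) (simp_all add: star_add)

lemma norm_square_selfadj:
  "star h = h \<Longrightarrow> norm (h * h) = (norm (h::'a::cstar_algebra))\<^sup>2"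
  using cstar_identity[of h] by simp

section \<open>Square roots and the positive cone\<close>

text \<open>
  The equation says $(1 - m)^2 = 1 - w$ without mentioning a unit.  Its solution is the fixed
  point of $m \mapsto (w + m^2) / 2$, a contraction of the ball of radius $\|w\|$ that preserves
  the closed set of self-adjoint elements of the bicommutant of $w$.  That the root lies in the
  bicommutant is what makes roots of commuting elements commute.
\<close>

lemma sqrt_one_minus:
  fixes w :: "'a::cstar_algebra"
  assumes sa: "star w = w" and w1: "norm w < 1"
  shows "\<exists>m. star m = m \<and> 2 *\<^sub>R m = w + m * m \<and> (\<forall>x. x * w = w * x \<longrightarrow> x * m = m * x)"
proof -
  define S where "S = {m. norm m \<le> norm w \<and> star m = m \<and> (\<forall>x. x * w = w * x \<longrightarrow> x * m = m * x)}"
  define f where "f m = (1/2) *\<^sub>R (w + m * m)" for m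
  have SD: "norm m \<le> norm w" "star m = m" "x * w = w * x \<Longrightarrow> x * m = m * x" if "m \<in> S" for m x
    using that unfolding S_def by blast+
  have S_eq: "S = {m. norm m \<le> norm w} \<inter> {m. star m = m} \<inter> (\<Inter>x\<in>{x. x * w = w * x}. {m. x * m = m * x})"
    by (auto simp: S_def)
  have "closed S"
    unfolding S_eq by (intro closed_Int closed_INT ballI closed_Collect_le closed_Collect_eq
        linear_continuous_on[OF bounded_linear_star] continuous_intros)
  then have "complete S" by (simp add: complete_eq_closed)
  moreover have "w \<in> S" using sa unfolding S_def by blast
  moreover have "f ` S \<subseteq> S"
  proof
    fix y assume "y \<in> f ` S"
    then obtain m where m: "m \<in> S" and y: "y = f m" by blast
    have "norm (w + m * m) \<le> norm w + norm m * norm m"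
      by (meson add_left_mono norm_mult_ineq norm_triangle_ineq order_trans)
    also have "\<dots> \<le> norm w + norm w * 1"
      using SD(1)[OF m] w1 by (intro add_left_mono mult_mono) auto
    finally have "norm y \<le> norm w" by (simp add: y f_def)
    moreover have "star y = y" using SD(2)[OF m] sa by (simp add: y f_def star_add star_mult)
    moreover have "x * y = y * x" if "x * w = w * x" for x
    proof -
      have xm: "x * m = m * x" using SD(3)[OF m that] .
      then have "x * (m * m) = (m * m) * x" by (metis mult.assoc)
      then show ?thesis using that by (simp add: y f_def distrib_left distrib_right)
    qed
    ultimately show "y \<in> S" unfolding S_def by blast
  qed
  moreover have "dist (f x) (f y) \<le> norm w * dist x y" if "x \<in> S" "y \<in> S" for x y
  proof -
    have "f x - f y = (1/2) *\<^sub>R (x * (x - y) + (x - y) * y)"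
      by (simp add: f_def algebra_simps)
    then have "norm (f x - f y) = (1/2) * norm (x * (x - y) + (x - y) * y)" by simp
    also have "\<dots> \<le> (1/2) * (norm x * norm (x - y) + norm (x - y) * norm y)"
      by (meson add_mono mult_left_mono norm_mult_ineq norm_triangle_le zero_le_divide_1_iff zero_le_numeral)
    also have "\<dots> \<le> (1/2) * (norm w * norm (x - y) + norm (x - y) * norm w)"
      using that by (intro mult_left_mono add_mono mult_right_mono) (auto simp: SD(1))
    finally show ?thesis by (simp add: dist_norm)
  qed
  ultimately have "\<exists>!x\<in>S. f x = x"
    using w1 by (intro Banach_fix[of S "norm w" f]) auto
  then obtain m where m: "m \<in> S" "f m = m" by blast
  have "2 *\<^sub>R m = 2 *\<^sub>R f m" using m by simp
  then have "2 *\<^sub>R m = w + m * m" by (simp add: f_def)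
  with m(1) show ?thesis unfolding S_def by blast
qed

text \<open>
  The unital algebras have sort \<open>{cstar_algebra, monoid_mult}\<close>, which, unlike \<open>ring_1\<close>, admits the
  zero algebra; hence the unit has norm at most 1, not equal to 1.
\<close>

lemma star_one [simp]: "star (1::'a::{cstar_algebra,monoid_mult}) = 1"
  by (metis mult_1_left mult_1_right star_mult star_star)

lemma norm_one_le: "norm (1::'a::{cstar_algebra,monoid_mult}) \<le> 1"
proof -
  have "norm (1::'a) = norm (1::'a) * norm (1::'a)"
    using cstar_identity[of "1::'a"] by (simp add: power2_eq_square)
  then have "norm (1::'a) = 0 \<or> norm (1::'a) = 1" by (metis mult_cancel_left1)
  then show ?thesis by auto
qed

lemma star_power: "star (x ^ n) = star (x::'a::{cstar_algebra,monoid_mult}) ^ n"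
  by (induction n) (simp_all add: star_mult power_commutes)

text \<open>
  For self-adjoint \<open>h\<close> the inequality places the spectrum in the disc of radius $r$ about $r$, hence
  in $[0, \infty)$.  In this form closure under sums is the triangle inequality.
\<close>

definition pos :: "'a::{cstar_algebra,monoid_mult} \<Rightarrow> bool" where
  "pos h \<longleftrightarrow> star h = h \<and> (\<exists>r\<ge>0. norm (r *\<^sub>R 1 - h) \<le> r)"

lemma norm_scaleR_one: "r \<ge> 0 \<Longrightarrow> norm (r *\<^sub>R (1::'a::{cstar_algebra,monoid_mult})) \<le> r"
  using norm_one_le[where 'a='a] by (simp add: mult_left_le)

lemma pos_selfadj: "pos h \<Longrightarrow> star h = h" by (simp add: pos_def)

lemma pos_zero [simp]: "pos 0" by (auto simp: pos_def intro: exI[of _ 0])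

lemma pos_add: assumes "pos h" "pos k" shows "pos (h + k)"
proof -
  obtain r s where r: "r \<ge> 0" "norm (r *\<^sub>R 1 - h) \<le> r" and s: "s \<ge> 0" "norm (s *\<^sub>R 1 - k) \<le> s"
    using assms by (auto simp: pos_def)
  have "(r + s) *\<^sub>R 1 - (h + k) = (r *\<^sub>R 1 - h) + (s *\<^sub>R 1 - k)" by (simp add: algebra_simps)
  then have "norm ((r + s) *\<^sub>R 1 - (h + k)) \<le> r + s" by (metis r(2) s(2) norm_triangle_mono)
  then show ?thesis using assms r s by (auto simp: pos_def star_add intro!: exI[of _ "r + s"])
qed

lemma pos_scaleR: assumes "pos h" "t \<ge> 0" shows "pos (t *\<^sub>R h)"
proof -
  obtain r where r: "r \<ge> 0" "norm (r *\<^sub>R 1 - h) \<le> r"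
    using assms by (auto simp: pos_def)
  have "(t * r) *\<^sub>R 1 - t *\<^sub>R h = t *\<^sub>R (r *\<^sub>R 1 - h)" by (simp add: algebra_simps)
  then have "norm ((t * r) *\<^sub>R 1 - t *\<^sub>R h) \<le> t * r" using r assms by (simp add: mult_left_mono)
  then show ?thesis using assms r by (auto simp: pos_def intro!: exI[of _ "t * r"])
qed

lemma pos_diff_of_norm_le:
  assumes "star h = h" "norm h \<le> r" shows "pos (r *\<^sub>R 1 - h)"
proof -
  have "r \<ge> 0" using assms norm_ge_zero order_trans by blast
  then show ?thesis using assms by (auto simp: pos_def star_diff intro!: exI[of _ r])
qed

lemma pos_add_of_norm_le:
  assumes "star h = h" "norm h \<le> r" shows "pos (r *\<^sub>R 1 + h)"
  using pos_diff_of_norm_le[of "- h" r] assms by simp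

lemma pos_scaleR_one: "t \<ge> 0 \<Longrightarrow> pos (t *\<^sub>R 1)"
  using pos_diff_of_norm_le[of 0 t] by simp

lemma sqrt_of_norm_less:
  fixes h :: "'a::{cstar_algebra,monoid_mult}"
  assumes sa: "star h = h" and r: "norm (r *\<^sub>R 1 - h) < r"
  shows "\<exists>k. star k = k \<and> k * k = h \<and> (\<forall>x. x * h = h * x \<longrightarrow> x * k = k * x)"
proof -
  have r0: "r > 0" using r norm_ge_zero le_less_trans by blast
  define w where "w = (1/r) *\<^sub>R (r *\<^sub>R 1 - h)"
  have "star w = w" using sa by (simp add: w_def star_diff)
  moreover have "norm w < 1" using r r0 by (simp add: w_def)
  ultimately obtain m where m: "star m = m" "2 *\<^sub>R m = w + m * m"
      "\<And>x. x * w = w * x \<Longrightarrow> x * m = m * x"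
    using sqrt_one_minus[of w] by blast
  define k where "k = sqrt r *\<^sub>R (1 - m)"
  have mm: "m * m = 2 *\<^sub>R m - w" using m(2) by simp
  have "k * k = r *\<^sub>R (1 - 2 *\<^sub>R m + m * m)"
    using r0 by (simp add: k_def algebra_simps scaleR_2)
  also have "\<dots> = r *\<^sub>R (1 - w)" by (simp add: mm)
  also have "\<dots> = h" using r0 by (simp add: w_def algebra_simps)
  finally have "k * k = h" .
  moreover have "star k = k" using m(1) by (simp add: k_def star_diff)
  moreover have "x * k = k * x" if "x * h = h * x" for x
  proof -
    have "x * w = w * x" using that by (simp add: w_def algebra_simps)
    from m(3)[OF this] show ?thesis by (simp add: k_def algebra_simps)
  qed
  ultimately show ?thesis by blast
qed

text \<open>
  Replacing $h$ by $h + e$ turns the weak inequality in the definition of \<open>pos\<close> into the strict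
  one that the contraction argument needs.
\<close>

lemma pos_shift_sqrt:
  assumes h: "pos h" and e: "e > 0"
  obtains k where "star k = k" "k * k = h + e *\<^sub>R 1" "\<And>x. x * h = h * x \<Longrightarrow> x * k = k * x"
proof -
  obtain r where r: "r \<ge> 0" "norm (r *\<^sub>R 1 - h) \<le> r"
    using h by (auto simp: pos_def)
  have "(r + e) *\<^sub>R 1 - (h + e *\<^sub>R 1) = r *\<^sub>R 1 - h" by (simp add: algebra_simps)
  then have "norm ((r + e) *\<^sub>R 1 - (h + e *\<^sub>R 1)) = norm (r *\<^sub>R 1 - h)" by (rule arg_cong)
  then have "norm ((r + e) *\<^sub>R 1 - (h + e *\<^sub>R 1)) < r + e" using r e by linarith
  moreover have "star (h + e *\<^sub>R 1) = h + e *\<^sub>R 1" using h by (simp add: pos_def star_add)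
  ultimately obtain k where k: "star k = k" "k * k = h + e *\<^sub>R 1"
      "\<And>x. x * (h + e *\<^sub>R 1) = (h + e *\<^sub>R 1) * x \<Longrightarrow> x * k = k * x"
    using sqrt_of_norm_less by blast
  have "x * k = k * x" if "x * h = h * x" for x
    using that by (intro k(3)) (simp add: algebra_simps)
  with k that show ?thesis by blast
qed

text \<open>
  The element $u = h + i k$ satisfies $u^* u = r^2$, and $h$ is its real part.
\<close>

lemma norm_le_of_squares:
  fixes h k :: "'a::{cstar_algebra,monoid_mult}"
  assumes "star h = h" "star k = k" "h * k = k * h" and sq: "h * h + k * k = (r\<^sup>2) *\<^sub>R 1" and r: "r \<ge> 0"
  shows "norm h \<le> r"
proof -
  define u where "u = h + cscale \<i> k"
  have su: "star u = h + cscale (- \<i>) k" using assms(1,2) by (simp add: u_def star_add star_cscale)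
  have "star u * u = (h + cscale (- \<i>) k) * (h + cscale \<i> k)" by (simp only: su) (simp only: u_def)
  also have "\<dots> = h * h + k * k"
    using assms(3)
    by (simp add: algebra_simps cscale_mult_left cscale_mult_right cscale_cscale cscale_minus_left
        cscale_add_right cscale_diff cscale_minus)
  finally have "star u * u = h * h + k * k" .
  then have "(norm u)\<^sup>2 \<le> r\<^sup>2"
    using norm_scaleR_one[of "r\<^sup>2"] by (metis cstar_identity sq zero_le_power2)
  then have "norm u \<le> r" using r by (rule power2_le_imp_le)
  moreover have "2 *\<^sub>R h = u + star u"
    by (simp only: su) (simp add: u_def cscale_minus_left scaleR_2)
  then have "2 * norm h \<le> norm u + norm u"
    by (metis norm_scaleR norm_star norm_triangle_ineq abs_numeral)
  ultimately show ?thesis by simp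
qed

text \<open>
  A square root $k$ of $r^2 - h^2$ satisfies $h^2 + k^2 = r^2$, which bounds $\|k\|$ by $r$.
\<close>

lemma norm_diff_square_le:
  fixes h :: "'a::{cstar_algebra,monoid_mult}"
  assumes sa: "star h = h" and r: "norm h < r"
  shows "norm ((r\<^sup>2) *\<^sub>R 1 - h * h) \<le> r\<^sup>2"
proof -
  have r0: "r > 0" using r norm_ge_zero le_less_trans by blast
  have "norm ((r\<^sup>2) *\<^sub>R 1 - ((r\<^sup>2) *\<^sub>R 1 - h * h)) < r\<^sup>2"
    using r by (simp add: norm_square_selfadj[OF sa] power_strict_mono)
  moreover have "star ((r\<^sup>2) *\<^sub>R 1 - h * h) = (r\<^sup>2) *\<^sub>R 1 - h * h"
    using sa by (simp add: star_diff star_mult)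
  ultimately obtain k where k: "star k = k" "k * k = (r\<^sup>2) *\<^sub>R 1 - h * h"
      "\<And>x. x * ((r\<^sup>2) *\<^sub>R 1 - h * h) = ((r\<^sup>2) *\<^sub>R 1 - h * h) * x \<Longrightarrow> x * k = k * x"
    using sqrt_of_norm_less by blast
  have "h * k = k * h" by (rule k(3)) (simp add: algebra_simps)
  then have "norm k \<le> r" using k sa r0 by (intro norm_le_of_squares[of k h]) (auto simp: algebra_simps)
  then have "norm (k * k) \<le> r\<^sup>2" using k(1) by (simp add: norm_square_selfadj power_mono)
  then show ?thesis by (simp add: k)
qed

lemma pos_square: "star h = h \<Longrightarrow> pos (h * h)"
  using norm_diff_square_le[of h "norm h + 1"]
  by (auto simp: pos_def star_mult intro!: exI[of _ "(norm h + 1)\<^sup>2"])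

text \<open>
  The radius in the definition of \<open>pos\<close> may be any bound of the norm.  This uniformity makes the
  cone closed.  It holds for squares by \<open>norm_diff_square_le\<close>, and $h + d$ is a square for each
  $d > 0$.
\<close>

lemma pos_norm_bound:
  assumes h: "pos h" and r: "norm h \<le> r"
  shows "norm (r *\<^sub>R 1 - h) \<le> r"
proof (rule field_le_epsilon)
  fix e :: real assume e: "e > 0"
  \<comment> \<open>One \<open>d\<close> makes \<open>h\<close> a square, one makes the bound on its root strict, one is lost when the shift is undone.\<close>
  define d where "d = e / 3"
  have d: "d > 0" using e by (simp add: d_def)
  have r0: "r \<ge> 0" using r norm_ge_zero order_trans by blast
  obtain k where k: "star k = k" "k * k = h + d *\<^sub>R 1" using pos_shift_sqrt[OF h d] by metis
  have "(norm k)\<^sup>2 = norm (h + d *\<^sub>R 1)" using k by (metis norm_square_selfadj)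
  also have "\<dots> \<le> r + d" using r norm_scaleR_one[of d] d
    by (meson less_imp_le norm_triangle_mono)
  also have "\<dots> < (sqrt (r + 2 * d))\<^sup>2" using d r0 by simp
  finally have "norm k < sqrt (r + 2 * d)" using d r0 by (meson power2_less_imp_less real_sqrt_ge_zero add_nonneg_nonneg less_imp_le mult_nonneg_nonneg zero_le_numeral)
  from norm_diff_square_le[OF k(1) this] have "norm ((r + 2 * d) *\<^sub>R 1 - (h + d *\<^sub>R 1)) \<le> r + 2 * d"
    using d r0 by (simp add: k)
  moreover have "r *\<^sub>R 1 - h = ((r + 2 * d) *\<^sub>R 1 - (h + d *\<^sub>R 1)) + (- d *\<^sub>R 1)"
    by (simp add: algebra_simps flip: scaleR_add_left)
  ultimately have "norm (r *\<^sub>R 1 - h) \<le> (r + 2 * d) + d"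
    using norm_scaleR_one[of d] d by (metis less_imp_le norm_minus_cancel norm_triangle_mono scaleR_minus_left)
  then show "norm (r *\<^sub>R 1 - h) \<le> r + e" by (simp add: d_def)
qed

lemma pos_limit:
  fixes h :: "'a::{cstar_algebra,monoid_mult}"
  assumes sa: "star h = h" and p: "\<And>e. e > 0 \<Longrightarrow> pos (h + e *\<^sub>R 1)"
  shows "pos h"
proof -
  have "norm ((norm h + 1) *\<^sub>R 1 - h) \<le> norm h + 1"
  proof (rule field_le_epsilon)
    fix e :: real assume e: "e > 0"
    define d where "d = min 1 e"
    have d: "d > 0" "d \<le> 1" "d \<le> e" using e by (auto simp: d_def)
    have "norm (h + d *\<^sub>R 1) \<le> norm h + 1"
      using norm_scaleR_one[of d] d
      by (meson add_left_mono less_imp_le norm_triangle_ineq order_trans)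
    from pos_norm_bound[OF p[OF d(1)] this]
    have "norm ((norm h + 1) *\<^sub>R 1 - (h + d *\<^sub>R 1)) \<le> norm h + 1" .
    moreover have "(norm h + 1) *\<^sub>R 1 - h = ((norm h + 1) *\<^sub>R 1 - (h + d *\<^sub>R 1)) + d *\<^sub>R 1" by simp
    moreover have "norm (d *\<^sub>R (1::'a)) \<le> e"
      using norm_scaleR_one[of d, where 'a='a] d by linarith
    ultimately show "norm ((norm h + 1) *\<^sub>R 1 - h) \<le> norm h + 1 + e"
      by (simp only: norm_triangle_mono)
  qed
  then show ?thesis using sa by (auto simp: pos_def intro!: exI[of _ "norm h + 1"])
qed

text \<open>
  Commuting $h$ and $k$ have commuting roots after a shift, so $(h + e) (k + e)$ is the square of a
  self-adjoint element; then let $e$ tend to 0.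
\<close>

lemma pos_mult:
  assumes h: "pos h" and k: "pos k" and comm: "h * k = k * h"
  shows "pos (h * k)"
proof (rule pos_limit)
  show sa: "star (h * k) = h * k" using assms by (simp add: pos_def star_mult)
  fix d :: real assume d: "d > 0"
  define s where "s = h + k"
  define e where "e = min 1 (d / (norm s + 1))"
  have e: "e > 0" "e \<le> 1" using d by (auto simp: e_def add_nonneg_pos)
  have "norm s + 1 > 0" by (simp add: add_nonneg_pos)
  then have e_le: "e * (norm (h + k) + 1) \<le> d"
    using mult_right_mono[of e "d / (norm s + 1)" "norm s + 1"] by (simp add: e_def s_def)
  obtain a where a: "star a = a" "a * a = h + e *\<^sub>R 1" "\<And>x. x * h = h * x \<Longrightarrow> x * a = a * x"
    using pos_shift_sqrt[OF h e(1)] by metis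
  obtain b where b: "star b = b" "b * b = k + e *\<^sub>R 1" "\<And>x. x * k = k * x \<Longrightarrow> x * b = b * x"
    using pos_shift_sqrt[OF k e(1)] by metis
  have "k * a = a * k" using comm by (intro a) simp
  then have ab: "a * b = b * a" by (intro b(3)) simp
  then have "star (a * b) = a * b" by (simp add: star_mult a b)
  then have "pos ((a * b) * (a * b))" by (rule pos_square)
  also have "(a * b) * (a * b) = (a * a) * (b * b)" by (metis ab mult.assoc)
  also have "\<dots> = h * k + (e *\<^sub>R (h + k) + e\<^sup>2 *\<^sub>R 1)"
    by (simp add: a b algebra_simps power2_eq_square)
  finally have p1: "pos (h * k + (e *\<^sub>R (h + k) + e\<^sup>2 *\<^sub>R 1))" .
  have "norm (e *\<^sub>R (h + k) + e\<^sup>2 *\<^sub>R 1) \<le> d"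
  proof -
    have "norm (e *\<^sub>R (h + k) + e\<^sup>2 *\<^sub>R (1::'a)) \<le> norm (e *\<^sub>R (h + k)) + norm (e\<^sup>2 *\<^sub>R (1::'a))"
      by (rule norm_triangle_ineq)
    also have "\<dots> \<le> e * norm (h + k) + e\<^sup>2"
      using norm_scaleR_one[of "e\<^sup>2", where 'a='a] e by simp
    also have "\<dots> \<le> e * norm (h + k) + e * 1"
      using e by (simp add: power2_eq_square)
    also have "\<dots> = e * (norm (h + k) + 1)" by (simp add: algebra_simps)
    finally show ?thesis using e_le by linarith
  qed
  moreover have "star (e *\<^sub>R (h + k) + e\<^sup>2 *\<^sub>R 1) = e *\<^sub>R (h + k) + e\<^sup>2 *\<^sub>R 1"
    using h k by (simp add: star_add pos_def)
  ultimately have "pos (d *\<^sub>R 1 - (e *\<^sub>R (h + k) + e\<^sup>2 *\<^sub>R 1))" by (rule pos_diff_of_norm_le[rotated])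
  from pos_add[OF p1 this] show "pos (h * k + d *\<^sub>R 1)" by (simp add: algebra_simps)
qed

section \<open>Positivity of the elements star y * y\<close>

lemma pos_power: "pos (v::'a::{cstar_algebra,monoid_mult}) \<Longrightarrow> pos (v ^ n)"
proof (induction n)
  case 0
  show ?case using pos_scaleR_one[of 1, where 'a='a] by simp
next
  case (Suc n)
  then show ?case by (simp add: pos_mult power_commutes)
qed

text \<open>
  Bernoulli's inequality in the commutative algebra generated by $v$.  The expressions $B_n$ satisfy
  $B_{n+1} = v B_n + n (v - 1)^2$.
\<close>

lemma power_bernoulli_pos:
  assumes v: "pos v"
  shows "pos (v ^ n - 1 - real n *\<^sub>R (v - 1))"
proof (induction n)
  case (Suc n)
  have sv: "star v = v" using v by (rule pos_selfadj)
  have "v ^ Suc n - 1 - real (Suc n) *\<^sub>R (v - 1)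
      = v * (v ^ n - 1 - real n *\<^sub>R (v - 1)) + real n *\<^sub>R ((v - 1) * (v - 1))"
    by (simp add: algebra_simps)
  moreover have "pos (v * (v ^ n - 1 - real n *\<^sub>R (v - 1)))"
    using v Suc by (intro pos_mult) (simp_all add: algebra_simps power_commutes)
  moreover have "pos ((v - 1) * (v - 1))" by (rule pos_square) (simp add: star_diff sv)
  ultimately show ?case by (simp only: pos_add pos_scaleR of_nat_0_le_iff)
qed simp

text \<open>
  The expressions $A_n$ satisfy $A_{n+1} = A_n + (n + 1) v^n (v - 1)^2$.
\<close>

lemma power_bernoulli_reverse_pos:
  assumes v: "pos v"
  shows "pos (real n *\<^sub>R v ^ Suc n - real (Suc n) *\<^sub>R v ^ n + 1)"
proof (induction n)
  case (Suc n)
  have sv: "star v = v" using v by (rule pos_selfadj)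
  have "real (Suc n) *\<^sub>R v ^ Suc (Suc n) - real (Suc (Suc n)) *\<^sub>R v ^ Suc n + 1
      = (real n *\<^sub>R v ^ Suc n - real (Suc n) *\<^sub>R v ^ n + 1) + real (Suc n) *\<^sub>R (v ^ n * ((v - 1) * (v - 1)))"
  proof -
    have "v ^ n * (v * v) = v * (v * v ^ n)" by (metis mult.assoc power_commutes)
    then show ?thesis by (simp add: algebra_simps power_commutes scaleR_2)
  qed
  moreover have "pos (v ^ n * ((v - 1) * (v - 1)))"
  proof (rule pos_mult)
    show "pos ((v - 1) * (v - 1))" by (rule pos_square) (simp add: star_diff sv)
    have "v ^ n * (v - 1) = (v - 1) * v ^ n" by (simp add: algebra_simps power_commutes)
    then show "v ^ n * ((v - 1) * (v - 1)) = (v - 1) * (v - 1) * v ^ n"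
      by (metis mult.assoc)
  qed (use v in \<open>simp add: pos_power\<close>)
  ultimately show ?case using Suc by (simp only: pos_add pos_scaleR of_nat_0_le_iff)
qed simp

text \<open>
  The polynomial $(1 - t) t^n$ is at most $1 / (n + 1)$ for $t \ge 0$.
\<close>

lemma one_minus_times_power_bound_pos:
  assumes v: "pos v"
  shows "pos ((1 / real (Suc n)) *\<^sub>R 1 - (1 - v) * v ^ n)"
proof -
  have "(1 / real (Suc n)) *\<^sub>R 1 - (1 - v) * v ^ n
      = (1 / real (Suc n)) *\<^sub>R ((real n *\<^sub>R v ^ Suc n - real (Suc n) *\<^sub>R v ^ n + 1) + v ^ Suc n)"
    by (simp add: algebra_simps field_simps flip: scaleR_add_left)
  then show ?thesis using v
    by (simp only: pos_add pos_scaleR power_bernoulli_reverse_pos pos_power of_nat_0_le_iff zero_le_divide_1_iff)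
qed

lemma power_diff_pos:
  assumes v: "pos v" and c: "c \<ge> 0" and g: "pos (c *\<^sub>R 1 - v)"
  shows "pos (c ^ n *\<^sub>R 1 - v ^ n)"
proof (induction n)
  case (Suc n)
  have "c ^ Suc n *\<^sub>R 1 - v ^ Suc n = c *\<^sub>R (c ^ n *\<^sub>R 1 - v ^ n) + (c *\<^sub>R 1 - v) * v ^ n"
    by (simp add: algebra_simps)
  moreover have "pos ((c *\<^sub>R 1 - v) * v ^ n)"
    using v g by (intro pos_mult) (simp_all add: pos_power algebra_simps power_commutes)
  ultimately show ?case using Suc c by (simp only: pos_add pos_scaleR)
qed simp

text \<open>
  With $z = h + i k$ the sum is $2 (h^2 + k^2)$.  This is where the complex structure is
  indispensable: in a real algebra $z^* z$ may be negative.
\<close>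

lemma pos_star_mult_add:
  fixes z :: "'a::{cstar_algebra,monoid_mult}"
  shows "pos (star z * z + z * star z)"
proof -
  define h where "h = z + star z"
  define k where "k = cscale \<i> (z - star z)"
  have "star h = h" by (simp add: h_def star_add star_star add.commute)
  moreover have "star k = k"
    by (simp add: k_def star_cscale star_diff star_star cscale_minus_left cscale_diff)
  ultimately have "pos ((1/2) *\<^sub>R (h * h + k * k))"
    by (intro pos_scaleR pos_add pos_square) auto
  also have "k * k = - ((z - star z) * (z - star z))"
    by (simp add: k_def cscale_mult_left cscale_mult_right cscale_cscale cscale_minus_left)
  also have "(1/2) *\<^sub>R (h * h + - ((z - star z) * (z - star z)))
      = (1/2) *\<^sub>R (2 *\<^sub>R (star z * z + z * star z))"
    by (simp add: h_def algebra_simps scaleR_2)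
  finally show ?thesis by simp
qed

text \<open>
  Let $a = y^* y$ and $b = y y^*$.  For $z = y (1 - a)^m$ one has $z^* z = a (1 - a)^{2m}$ and
  $z z^* = b (1 - b)^{2m}$.  The sum of the two is positive, and $t (1 - t)^{2m} \le 1 / (2m + 1)$
  for $t \le 1$, so $a (1 - a)^{2m} \ge - 1 / (2m + 1)$.  But $t (1 - t)^{2m} \le t$ for $t \le 0$, so
  that $a \ge - 1 / (2m + 1)$ for all $m$.
  
  The last conclusion is drawn without functional calculus as follows.  Let $t_0$ be the least
  $t \ge 0$ with $a + t \ge 0$.  If $t_0 > 0$, an explicit combination of positive elements shows
  $a + t_0 \ge \delta$ for some $\delta > 0$, against the choice of $t_0$.
\<close>

lemma pos_star_mult_self_contraction:
  fixes y :: "'a::{cstar_algebra,monoid_mult}"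
  assumes y1: "norm y \<le> 1"
  shows "pos (star y * y)"
proof -
  define a b where "a = star y * y" and "b = y * star y"
  define v w where "v = 1 - a" and "w = 1 - b"
  have sa: "star a = a" and sb: "star b = b"
    by (simp_all add: a_def b_def star_mult star_star)
  have na: "norm a \<le> 1" using y1 by (simp add: a_def cstar_identity power_le_one)
  have nb: "norm b \<le> 1"
    using y1 cstar_identity[of "star y"] by (simp add: b_def star_star power_le_one)
  have pv: "pos v" using pos_diff_of_norm_le[OF sa na] by (simp add: v_def)
  have pw: "pos w" using pos_diff_of_norm_le[OF sb nb] by (simp add: w_def)
  have ywv: "y * v ^ n = w ^ n * y" for n
  proof (induction n)
    case (Suc n)
    have "y * v = w * y" by (simp add: v_def w_def a_def b_def algebra_simps)
    then have "y * v ^ Suc n = w * (y * v ^ n)" by (simp flip: mult.assoc)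
    also have "\<dots> = w ^ Suc n * y" by (simp add: Suc mult.assoc)
    finally show ?case .
  qed simp
  have a_v: "1 - v = a" and b_w: "1 - w = b" by (simp_all add: v_def w_def)
  have va: "a * v ^ n = v ^ n * a" for n
    using power_commuting_commutes[of v a n] by (simp add: v_def algebra_simps)
  have wb: "b * w ^ n = w ^ n * b" for n
    using power_commuting_commutes[of w b n] by (simp add: w_def algebra_simps)
  have key: "pos ((1 - v) * v ^ (2 * m) + (1 / real (Suc (2 * m))) *\<^sub>R 1)" for m
  proof -
    define z where "z = y * v ^ m"
    have svm: "star (v ^ m) = v ^ m" using pos_selfadj[OF pv] by (simp add: star_power)
    have "star z * z = v ^ m * (a * v ^ m)"
      by (simp add: z_def star_mult svm a_def mult.assoc)
    also have "a * v ^ m = v ^ m * a" using va .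
    also have "v ^ m * (v ^ m * a) = v ^ (2 * m) * a" by (simp add: mult_2 power_add mult.assoc)
    also have "\<dots> = (1 - v) * v ^ (2 * m)" using va[of "2 * m"] by (simp add: a_v)
    finally have zz: "star z * z = (1 - v) * v ^ (2 * m)" .
    have "z * star z = y * (v ^ m * v ^ m) * star y"
      by (simp add: z_def star_mult svm mult.assoc)
    also have "\<dots> = w ^ (2 * m) * b" 
      by (simp add: mult_2 power_add[symmetric] ywv b_def mult.assoc)
    also have "\<dots> = (1 - w) * w ^ (2 * m)" using wb[of "2 * m"] by (simp add: b_w)
    finally have zz': "z * star z = (1 - w) * w ^ (2 * m)" .
    have "pos ((star z * z + z * star z) + ((1 / real (Suc (2 * m))) *\<^sub>R 1 - (1 - w) * w ^ (2 * m)))"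
      by (intro pos_add pos_star_mult_add one_minus_times_power_bound_pos pw)
    then show ?thesis by (simp add: zz zz' algebra_simps)
  qed
  define T where "T = {t. t \<ge> 0 \<and> pos (a + t *\<^sub>R 1)}"
  define t0 where "t0 = Inf T"
  have T1: "1 \<in> T" using pos_add_of_norm_le[OF sa na] by (simp add: T_def add.commute)
  have bdd: "bdd_below T" by (rule bdd_belowI[of _ 0]) (simp add: T_def)
  have t0: "t0 \<ge> 0" unfolding t0_def by (rule cInf_greatest) (use T1 in blast, simp add: T_def)
  have up: "pos (a + t *\<^sub>R 1)" if "t > t0" for t
  proof -
    have "T \<noteq> {}" using T1 by auto
    from cInf_lessD[OF this that[unfolded t0_def]] obtain s where s: "s \<in> T" "s < t" ..
    have "a + t *\<^sub>R 1 = (a + s *\<^sub>R 1) + (t - s) *\<^sub>R 1" by (simp add: algebra_simps)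
    moreover have "pos (a + s *\<^sub>R 1)" using s by (simp add: T_def)
    moreover have "pos ((t - s) *\<^sub>R (1::'a))" using s by (intro pos_scaleR_one) simp
    ultimately show ?thesis by (simp only: pos_add)
  qed
  define g where "g = a + t0 *\<^sub>R 1"
  have pg: "pos g"
  proof (rule pos_limit)
    show "star g = g" by (simp add: g_def star_add sa)
    fix e :: real assume "e > 0"
    then show "pos (g + e *\<^sub>R 1)" using up[of "t0 + e"] by (simp add: g_def scaleR_add_left add.assoc)
  qed
  have "t0 = 0"
  proof (rule ccontr)
    assume "t0 \<noteq> 0"
    with t0 have tp: "t0 > 0" by simp
    obtain m where m: "1 / t0 < real m" using reals_Archimedean2 by blast
    define M where "M = 2 * m"
    define \<epsilon> where "\<epsilon> = 1 / real (Suc M)"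
    have "1 / t0 < real (Suc M)" using m by (simp add: M_def)
    then have eps: "\<epsilon> < t0" using tp by (simp add: \<epsilon>_def field_simps)
    define c where "c = 1 + t0"
    have gv: "g = c *\<^sub>R 1 - v" by (simp add: g_def c_def v_def algebra_simps)
    \<comment> \<open>The constants are dictated by the identity for \<open>C *\<^sub>R g - (C * \<delta>) *\<^sub>R 1\<close> below.  Its three summands bound
      $v^M (v - 1)$ by $\epsilon$, replace $v^M$ by its upper bound $c^M$ in front of $g$, and bound $v^M$ below by Bernoulli.\<close>
    define C where "C = c ^ M + real M * t0"
    define \<delta> where "\<delta> = (t0 - \<epsilon> + real M * t0 * t0) / C"
    have C: "C > 0" using tp by (simp add: C_def c_def add_pos_nonneg)
    have delta: "\<delta> > 0" using eps tp C by (simp add: \<delta>_def add_pos_nonneg)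
    have p1: "pos ((1 - v) * v ^ M + \<epsilon> *\<^sub>R 1)" using key[of m] by (simp add: M_def \<epsilon>_def)
    have p2: "pos ((c ^ M *\<^sub>R 1 - v ^ M) * g)"
    proof (rule pos_mult)
      show "pos (c ^ M *\<^sub>R 1 - v ^ M)"
        by (rule power_diff_pos[OF pv]) (use pg t0 in \<open>simp_all add: gv[symmetric], simp add: c_def\<close>)
      show "(c ^ M *\<^sub>R 1 - v ^ M) * g = g * (c ^ M *\<^sub>R 1 - v ^ M)"
        by (simp add: gv algebra_simps power_commutes)
    qed (rule pg)
    have p3: "pos (t0 *\<^sub>R (v ^ M - 1 - real M *\<^sub>R (v - 1)))"
      using t0 by (intro pos_scaleR power_bernoulli_pos pv)
    have "C *\<^sub>R g - (C * \<delta>) *\<^sub>R 1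
        = ((1 - v) * v ^ M + \<epsilon> *\<^sub>R 1) + (c ^ M *\<^sub>R 1 - v ^ M) * g + t0 *\<^sub>R (v ^ M - 1 - real M *\<^sub>R (v - 1))"
    proof -
      have e1: "1 - v = g - t0 *\<^sub>R 1" and e2: "v - 1 = t0 *\<^sub>R 1 - g"
        by (simp_all add: g_def v_def)
      have "v ^ M * g = g * v ^ M" by (simp add: gv algebra_simps power_commutes)
      moreover have Cd: "C * \<delta> = t0 - \<epsilon> + real M * t0 * t0" using C by (simp add: \<delta>_def)
      ultimately show ?thesis
        unfolding e1 e2 Cd by (simp add: C_def algebra_simps)
    qed
    then have "pos (C *\<^sub>R g - (C * \<delta>) *\<^sub>R 1)" using p1 p2 p3 by (simp only: pos_add)
    then have "pos ((1 / C) *\<^sub>R (C *\<^sub>R g - (C * \<delta>) *\<^sub>R 1))" using C by (intro pos_scaleR) auto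
    also have "(1 / C) *\<^sub>R (C *\<^sub>R g - (C * \<delta>) *\<^sub>R 1) = g - \<delta> *\<^sub>R 1"
      using C by (simp add: algebra_simps)
    finally have pd: "pos (g - \<delta> *\<^sub>R 1)" .
    \<comment> \<open>The set \<open>T\<close> contains only nonnegative numbers, so the gain is capped at \<open>t0\<close>.\<close>
    define d where "d = min \<delta> t0"
    have "pos ((g - \<delta> *\<^sub>R 1) + (\<delta> - d) *\<^sub>R 1)"
      by (intro pos_add pd pos_scaleR_one) (simp add: d_def)
    also have "(g - \<delta> *\<^sub>R 1) + (\<delta> - d) *\<^sub>R 1 = a + (t0 - d) *\<^sub>R 1" by (simp add: g_def algebra_simps)
    finally have "t0 - d \<in> T" by (simp add: T_def d_def)
    then have "t0 \<le> t0 - d" unfolding t0_def using bdd by (rule cInf_lower)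
    then show False using delta tp by (simp add: d_def)
  qed
  then show ?thesis using pg by (simp add: g_def a_def)
qed

theorem pos_star_mult_self:
  fixes y :: "'a::{cstar_algebra,monoid_mult}"
  shows "pos (star y * y)"
proof -
  define r where "r = norm y + 1"
  have r: "r > 0" by (simp add: r_def add_nonneg_pos)
  define x where "x = (1 / r) *\<^sub>R y"
  have "norm x \<le> 1" using r by (simp add: x_def) (simp add: r_def)
  then have "pos ((r * r) *\<^sub>R (star x * x))"
    by (intro pos_scaleR pos_star_mult_self_contraction) auto
  also have "(r * r) *\<^sub>R (star x * x) = star y * y" using r by (simp add: x_def)
  finally show ?thesis .
qed

text \<open>
  Both $r - x = (r - (x + c)) + c$ and $r + x = (r + (x - d)) + d$ are positive.  Up to a shift by
  $e$ they have commuting roots, whose product is a root of $(r + e)^2 - x^2$.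
\<close>

theorem norm_le_of_order_bounds:
  fixes x :: "'a::{cstar_algebra,monoid_mult}"
  assumes sx: "star x = x" and c: "pos c" and d: "pos d"
    and nc: "norm (x + c) \<le> r" and nd: "norm (x - d) \<le> r"
  shows "norm x \<le> r"
proof (rule field_le_epsilon)
  fix e :: real assume e: "e > 0"
  have r: "r \<ge> 0" using nc norm_ge_zero order_trans by blast
  define h k where "h = r *\<^sub>R 1 - x" and "k = r *\<^sub>R 1 + x"
  have "pos ((r *\<^sub>R 1 - (x + c)) + c)"
    using c nc by (intro pos_add pos_diff_of_norm_le) (simp_all add: star_add sx pos_selfadj)
  then have ph: "pos h" by (simp add: h_def algebra_simps)
  have "pos ((r *\<^sub>R 1 + (x - d)) + d)"
    using d nd by (intro pos_add pos_add_of_norm_le) (simp_all add: star_diff sx pos_selfadj)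
  then have pk: "pos k" by (simp add: k_def algebra_simps)
  obtain \<alpha> where a: "star \<alpha> = \<alpha>" "\<alpha> * \<alpha> = h + e *\<^sub>R 1" "\<And>x. x * h = h * x \<Longrightarrow> x * \<alpha> = \<alpha> * x"
    using pos_shift_sqrt[OF ph e] by metis
  obtain \<beta> where b: "star \<beta> = \<beta>" "\<beta> * \<beta> = k + e *\<^sub>R 1" "\<And>x. x * k = k * x \<Longrightarrow> x * \<beta> = \<beta> * x"
    using pos_shift_sqrt[OF pk e] by metis
  have xa: "x * \<alpha> = \<alpha> * x" by (rule a(3)) (simp add: h_def algebra_simps)
  have xb: "x * \<beta> = \<beta> * x" by (rule b(3)) (simp add: k_def algebra_simps)
  have ab: "\<alpha> * \<beta> = \<beta> * \<alpha>" by (rule b(3)) (simp add: k_def algebra_simps xa)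
  have "(\<alpha> * \<beta>) * (\<alpha> * \<beta>) = (\<alpha> * \<alpha>) * (\<beta> * \<beta>)" by (metis ab mult.assoc)
  also have "\<dots> = ((r + e) *\<^sub>R 1 - x) * ((r + e) *\<^sub>R 1 + x)"
    by (simp add: a b h_def k_def algebra_simps)
  also have "\<dots> = (r + e)\<^sup>2 *\<^sub>R 1 - x * x"
  proof -
    have "(s *\<^sub>R 1 - x) * (s *\<^sub>R 1 + x) = s\<^sup>2 *\<^sub>R 1 - x * x" for s
      by (simp add: algebra_simps power2_eq_square)
    then show ?thesis .
  qed
  finally have "x * x + (\<alpha> * \<beta>) * (\<alpha> * \<beta>) = (r + e)\<^sup>2 *\<^sub>R 1" by simp
  moreover have "x * (\<alpha> * \<beta>) = (\<alpha> * \<beta>) * x" 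
    by (simp add: mult.assoc flip: xb) (simp add: xa flip: mult.assoc)
  moreover have "star (\<alpha> * \<beta>) = \<alpha> * \<beta>" using a(1) b(1) ab by (simp add: star_mult)
  ultimately show "norm x \<le> r + e" using sx r e by (intro norm_le_of_squares) auto
qed

section \<open>The multiplier algebra\<close>

text \<open>
  Adjointness with respect to the algebra-valued inner product $y^* z$.  The adjointable operators
  form the multiplier algebra, a unital C*-algebra that contains the given one through its left
  multiplications.  As it consists of bounded operators, its completeness only
  requires that limits of adjointable operators be adjointable.
\<close>

definition adjoint_pair :: "('a::cstar_algebra \<Rightarrow>\<^sub>L 'a) \<Rightarrow> ('a \<Rightarrow>\<^sub>L 'a) \<Rightarrow> bool" where
  "adjoint_pair T S \<longleftrightarrow> (\<forall>y z. star (T y) * z = star y * S z)"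

lemma adjoint_pairD: "adjoint_pair T S \<Longrightarrow> star (T y) * z = star y * S z"
  by (simp add: adjoint_pair_def)

lemma star_mult_self_eq_0D: "star x * x = 0 \<Longrightarrow> x = (0::'a::cstar_algebra)"
  using cstar_identity[of x] by simp

lemma left_mult_cancel: 
  assumes "\<And>y. star y * a = star y * (b::'a::cstar_algebra)" shows "a = b"
proof -
  have "star (a - b) * (a - b) = 0" using assms[of "a - b"] by (simp add: right_diff_distrib)
  then show ?thesis using star_mult_self_eq_0D by fastforce
qed

lemma adjoint_pair_unique: "adjoint_pair T S \<Longrightarrow> adjoint_pair T S' \<Longrightarrow> S = S'"
  by (rule blinfun_eqI, rule left_mult_cancel) (simp flip: adjoint_pairD)

lemma adjoint_pair_sym: "adjoint_pair T S \<Longrightarrow> adjoint_pair S T"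
proof -
  assume "adjoint_pair T S"
  then have "star (star (T z) * y) = star (star z * S y)" for y z by (simp add: adjoint_pairD)
  then show ?thesis by (simp add: adjoint_pair_def star_mult star_star)
qed

lemma adjoint_pair_norm_le:
  assumes "adjoint_pair T S" shows "norm T \<le> norm S"
proof (rule norm_blinfun_bound)
  fix y
  show "norm (T y) \<le> norm S * norm y"
  proof (cases "T y = 0")
    case False
    have "norm (T y) * norm (T y) = norm (star y * S (T y))"
      using cstar_identity[of "T y"] adjoint_pairD[OF assms, of y "T y"] by (simp add: power2_eq_square)
    also have "\<dots> \<le> norm y * norm (S (T y))"
      using norm_mult_ineq[of "star y" "S (T y)"] by simp
    also have "\<dots> \<le> norm y * (norm S * norm (T y))"
      by (intro mult_left_mono norm_blinfun) simp
    finally have "norm (T y) * norm (T y) \<le> (norm S * norm y) * norm (T y)" by (simp add: algebra_simps)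
    then show ?thesis using False by simp
  qed simp
qed simp

lemma adjoint_pair_norm: "adjoint_pair T S \<Longrightarrow> norm T = norm S"
  using adjoint_pair_norm_le[of T S] adjoint_pair_norm_le[of S T] adjoint_pair_sym[of T S] by simp

lemma bounded_linear_cscale: "bounded_linear (cscale c :: 'a::cstar_algebra \<Rightarrow> 'a)"
  by (rule bounded_linear_intro[where K="cmod c"])
    (simp_all add: cscale_add_right cscale_scaleR norm_cscale)

definition cscale_blinfun :: "complex \<Rightarrow> 'a::cstar_algebra \<Rightarrow>\<^sub>L 'a" where
  "cscale_blinfun c = Blinfun (cscale c)"

lemma cscale_blinfun_apply [simp]: "cscale_blinfun c x = cscale c x"
  by (simp add: cscale_blinfun_def bounded_linear_Blinfun_apply bounded_linear_cscale)

lemma adjoint_pair_zero: "adjoint_pair 0 0"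
  by (simp add: adjoint_pair_def)

lemma adjoint_pair_id: "adjoint_pair id_blinfun id_blinfun"
  by (simp add: adjoint_pair_def)

lemma adjoint_pair_add:
  "adjoint_pair T S \<Longrightarrow> adjoint_pair T' S' \<Longrightarrow> adjoint_pair (T + T') (S + S')"
  by (simp add: adjoint_pair_def blinfun.bilinear_simps star_add distrib_left distrib_right)

lemma adjoint_pair_diff:
  "adjoint_pair T S \<Longrightarrow> adjoint_pair T' S' \<Longrightarrow> adjoint_pair (T - T') (S - S')"
  by (simp add: adjoint_pair_def blinfun.bilinear_simps star_diff left_diff_distrib right_diff_distrib)

lemma adjoint_pair_minus: "adjoint_pair T S \<Longrightarrow> adjoint_pair (- T) (- S)"
  by (simp add: adjoint_pair_def blinfun.bilinear_simps)

lemma adjoint_pair_scaleR: "adjoint_pair T S \<Longrightarrow> adjoint_pair (r *\<^sub>R T) (r *\<^sub>R S)"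
  by (simp add: adjoint_pair_def blinfun.bilinear_simps)

lemma adjoint_pair_compose:
  "adjoint_pair T S \<Longrightarrow> adjoint_pair T' S' \<Longrightarrow> adjoint_pair (T o\<^sub>L T') (S' o\<^sub>L S)"
  by (simp add: adjoint_pair_def)

lemma adjoint_pair_cscale: "adjoint_pair (cscale_blinfun c) (cscale_blinfun (cnj c))"
  by (simp add: adjoint_pair_def star_cscale cscale_mult_left cscale_mult_right)

text \<open>
  Operators in \<open>\<Rightarrow>\<^sub>L\<close> are only real-linear; adjointable ones are complex-linear because the inner product is.
\<close>

lemma adjoint_pair_cscale_commute:
  assumes "adjoint_pair T S" shows "T (cscale c z) = cscale c (T z)"
  by (rule left_mult_cancel)
    (simp add: cscale_mult_right flip: adjoint_pairD[OF adjoint_pair_sym[OF assms]])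

lemma adjoint_pair_limit:
  assumes "X \<longlonglongrightarrow> T" "Y \<longlonglongrightarrow> S" "\<And>n. adjoint_pair (X n) (Y n)"
  shows "adjoint_pair T S"
  unfolding adjoint_pair_def
proof (intro allI)
  fix y z
  have "(\<lambda>n. star (X n y) * z) \<longlonglongrightarrow> star (T y) * z"
    by (intro tendsto_mult tendsto_const bounded_linear.tendsto[OF bounded_linear_star] blinfun.tendsto assms)
  moreover have "(\<lambda>n. star y * Y n z) \<longlonglongrightarrow> star y * S z"
    by (intro tendsto_mult tendsto_const blinfun.tendsto assms)
  ultimately show "star (T y) * z = star y * S z"
    using adjoint_pairD[OF assms(3)] by (simp add: LIMSEQ_unique)
qed

typedef (overloaded) 'a multiplier = "{T :: 'a::cstar_algebra \<Rightarrow>\<^sub>L 'a. \<exists>S. adjoint_pair T S}"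
  using adjoint_pair_zero by auto

setup_lifting type_definition_multiplier

definition adjoint :: "('a::cstar_algebra \<Rightarrow>\<^sub>L 'a) \<Rightarrow> 'a \<Rightarrow>\<^sub>L 'a" where
  "adjoint T = (THE S. adjoint_pair T S)"

lemma adjoint_eq: "adjoint_pair T S \<Longrightarrow> adjoint T = S"
  unfolding adjoint_def by (blast intro: adjoint_pair_unique)

lemma adjoint_pair_adjoint: "\<exists>S. adjoint_pair T S \<Longrightarrow> adjoint_pair T (adjoint T)"
  using adjoint_eq by blast

instantiation multiplier :: (cstar_algebra) real_normed_algebra
begin

lift_definition zero_multiplier :: "'a multiplier" is 0
  using adjoint_pair_zero by blast
lift_definition plus_multiplier :: "'a multiplier \<Rightarrow> 'a multiplier \<Rightarrow> 'a multiplier" is "(+)"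
  using adjoint_pair_add by blast
lift_definition minus_multiplier :: "'a multiplier \<Rightarrow> 'a multiplier \<Rightarrow> 'a multiplier" is "(-)"
  using adjoint_pair_diff by blast
lift_definition uminus_multiplier :: "'a multiplier \<Rightarrow> 'a multiplier" is uminus
  using adjoint_pair_minus by blast
lift_definition times_multiplier :: "'a multiplier \<Rightarrow> 'a multiplier \<Rightarrow> 'a multiplier" is "(o\<^sub>L)"
  using adjoint_pair_compose by blast
lift_definition scaleR_multiplier :: "real \<Rightarrow> 'a multiplier \<Rightarrow> 'a multiplier" is "(*\<^sub>R)"
  using adjoint_pair_scaleR by blast
lift_definition norm_multiplier :: "'a multiplier \<Rightarrow> real" is norm .
definition dist_multiplier :: "'a multiplier \<Rightarrow> 'a multiplier \<Rightarrow> real" where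
  "dist_multiplier a b = norm (a - b)"
definition uniformity_multiplier :: "('a multiplier \<times> 'a multiplier) filter" where
  "uniformity_multiplier = (INF e\<in>{0 <..}. principal {(x, y). dist x y < e})"
definition open_multiplier :: "'a multiplier set \<Rightarrow> bool" where
  "open_multiplier S = (\<forall>x\<in>S. \<forall>\<^sub>F (x', y) in uniformity. x' = x \<longrightarrow> y \<in> S)"
definition sgn_multiplier :: "'a multiplier \<Rightarrow> 'a multiplier" where
  "sgn_multiplier x = scaleR (inverse (norm x)) x"

instance
proof
  fix a b c :: "'a multiplier" and r s :: real
  show "a + b + c = a + (b + c)" "a + b = b + a" "0 + a = a" "- a + a = 0" "a - b = a + - b"
    "r *\<^sub>R (a + b) = r *\<^sub>R a + r *\<^sub>R b" "(r + s) *\<^sub>R a = r *\<^sub>R a + s *\<^sub>R a"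
    "r *\<^sub>R s *\<^sub>R a = (r * s) *\<^sub>R a" "1 *\<^sub>R a = a"
    by (transfer, simp add: algebra_simps)+
  show "a * b * c = a * (b * c)" "(a + b) * c = a * c + b * c" "a * (b + c) = a * b + a * c"
    "r *\<^sub>R a * b = r *\<^sub>R (a * b)" "a * r *\<^sub>R b = r *\<^sub>R (a * b)"
    by (transfer, rule blinfun_eqI, simp add: blinfun.bilinear_simps)+
  show "dist a b = norm (a - b)" by (rule dist_multiplier_def)
  show "sgn a = inverse (norm a) *\<^sub>R a" by (rule sgn_multiplier_def)
  show "uniformity = (INF e\<in>{0 <..}. principal {(x, y::'a multiplier). dist x y < e})"
    by (rule uniformity_multiplier_def)
  show "open U = (\<forall>x\<in>U. \<forall>\<^sub>F (x', y) in uniformity. x' = x \<longrightarrow> y \<in> U)" for U :: "'a multiplier set"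
    by (rule open_multiplier_def)
  show "norm (a + b) \<le> norm a + norm b" by transfer (rule norm_triangle_ineq)
  show "norm a = 0 \<longleftrightarrow> a = 0" "norm (r *\<^sub>R a) = \<bar>r\<bar> * norm a" by (transfer, simp)+
  show "norm (a * b) \<le> norm a * norm b" by transfer (rule norm_blinfun_compose)
qed

end

text \<open>
  The adjoints of a Cauchy sequence form a Cauchy sequence too, since an operator and its adjoint
  have the same norm.
\<close>

instance multiplier :: (cstar_algebra) banach
proof
  fix X :: "nat \<Rightarrow> 'a multiplier"
  assume X: "Cauchy X"
  define T where "T n = Rep_multiplier (X n)" for n
  define S where "S n = adjoint (T n)" for n
  have adj: "adjoint_pair (T n) (S n)" for n
    using Rep_multiplier[of "X n"] adjoint_pair_adjoint by (auto simp: T_def S_def)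
  have nT: "norm (T m - T n) = norm (X m - X n)" for m n
    by (simp add: T_def norm_multiplier.rep_eq minus_multiplier.rep_eq)
  have nS: "norm (S m - S n) = norm (X m - X n)" for m n
    using adjoint_pair_norm[OF adjoint_pair_diff[OF adj[of m] adj[of n]]] by (simp add: nT)
  have "Cauchy T" "Cauchy S" using X by (simp_all add: Cauchy_iff nT nS)
  then obtain T' S' where T': "T \<longlonglongrightarrow> T'" and S': "S \<longlonglongrightarrow> S'"
    by (auto simp: Cauchy_convergent_iff convergent_def)
  have "adjoint_pair T' S'" using adjoint_pair_limit[OF T' S' adj] .
  then have rep: "Rep_multiplier (Abs_multiplier T') = T'" by (intro Abs_multiplier_inverse) blast
  have "norm (X n - Abs_multiplier T') = norm (T n - T')" for n
    by (simp add: T_def norm_multiplier.rep_eq minus_multiplier.rep_eq rep)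
  moreover have "(\<lambda>n. norm (T n - T')) \<longlonglongrightarrow> 0" using T' by (simp add: LIM_zero tendsto_norm_zero)
  ultimately have "(\<lambda>n. norm (X n - Abs_multiplier T')) \<longlonglongrightarrow> 0" by simp
  then have "X \<longlonglongrightarrow> Abs_multiplier T'"
    by (simp only: tendsto_norm_zero_iff LIM_zero_iff)
  then show "convergent X" by (rule convergentI)
qed

instantiation multiplier :: (cstar_algebra) "{cstar_algebra, monoid_mult}"
begin

lift_definition one_multiplier :: "'a multiplier" is id_blinfun
  using adjoint_pair_id by blast
lift_definition cscale_multiplier :: "complex \<Rightarrow> 'a multiplier \<Rightarrow> 'a multiplier"
  is "\<lambda>c T. cscale_blinfun c o\<^sub>L T"
  using adjoint_pair_compose adjoint_pair_cscale by blast
lift_definition star_multiplier :: "'a multiplier \<Rightarrow> 'a multiplier" is adjoint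
  using adjoint_pair_adjoint adjoint_pair_sym by blast

instance
proof
  fix a b c :: "'a multiplier" and r s :: real and z w :: complex
  show "1 * a = a" "a * 1 = a"
    by (transfer, rule blinfun_eqI, simp)+
  show "cscale z (a + b) = cscale z a + cscale z b" "cscale (z + w) a = cscale z a + cscale w a"
    "cscale z (cscale w a) = cscale (z * w) a" "cscale (complex_of_real r) a = r *\<^sub>R a"
    "cscale z a * b = cscale z (a * b)"
    by (transfer, rule blinfun_eqI,
      simp add: blinfun.bilinear_simps cscale_add_right cscale_add_left cscale_cscale cscale_of_real)+
  show "a * cscale z b = cscale z (a * b)"
    by (transfer, rule blinfun_eqI, auto simp: adjoint_pair_cscale_commute)
  show "norm (cscale z a) = cmod z * norm a"
  proof (transfer, rule antisym)
    fix z and T :: "'a \<Rightarrow>\<^sub>L 'a"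
    have le: "norm (cscale_blinfun z o\<^sub>L T) \<le> cmod z * norm T" for z and T :: "'a \<Rightarrow>\<^sub>L 'a"
      by (rule norm_blinfun_bound) (simp_all add: norm_cscale mult.assoc mult_left_mono norm_blinfun)
    show "norm (cscale_blinfun z o\<^sub>L T) \<le> cmod z * norm T" by (rule le)
    show "cmod z * norm T \<le> norm (cscale_blinfun z o\<^sub>L T)"
    proof (cases "z = 0")
      case False
      have "cscale_blinfun (inverse z) o\<^sub>L (cscale_blinfun z o\<^sub>L T) = T"
        by (rule blinfun_eqI) (simp add: cscale_cscale False)
      then have "norm T \<le> cmod (inverse z) * norm (cscale_blinfun z o\<^sub>L T)" using le[of "inverse z" "cscale_blinfun z o\<^sub>L T"] by simp
      then show ?thesis using False by (simp add: norm_inverse norm_divide field_simps)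
    qed simp
  qed
  show "star (star a) = a"
  proof (transfer, elim exE)
    fix T S :: "'a \<Rightarrow>\<^sub>L 'a" assume TS: "adjoint_pair T S"
    show "adjoint (adjoint T) = T"
      by (simp add: adjoint_eq[OF TS] adjoint_eq[OF adjoint_pair_sym[OF TS]])
  qed
  show "star (a + b) = star a + star b" "star (a * b) = star b * star a"
  proof (transfer, elim exE)
    fix T T' S S' :: "'a \<Rightarrow>\<^sub>L 'a" assume TS: "adjoint_pair T S" and TS': "adjoint_pair T' S'"
    show "adjoint (T + T') = adjoint T + adjoint T'"
      by (simp add: adjoint_eq[OF TS] adjoint_eq[OF TS'] adjoint_eq[OF adjoint_pair_add[OF TS TS']])
  next
    show "star (a * b) = star b * star a"
    proof (transfer, elim exE)
      fix T T' S S' :: "'a \<Rightarrow>\<^sub>L 'a" assume TS: "adjoint_pair T S" and TS': "adjoint_pair T' S'"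
      show "adjoint (T o\<^sub>L T') = adjoint T' o\<^sub>L adjoint T"
        by (simp add: adjoint_eq[OF TS] adjoint_eq[OF TS'] adjoint_eq[OF adjoint_pair_compose[OF TS TS']])
    qed
  qed
  show "star (cscale z a) = cscale (cnj z) (star a)" 
  proof (transfer, elim exE)
    fix z and T S :: "'a \<Rightarrow>\<^sub>L 'a" assume TS: "adjoint_pair T S"
    have "adjoint (cscale_blinfun z o\<^sub>L T) = S o\<^sub>L cscale_blinfun (cnj z)"
      by (intro adjoint_eq adjoint_pair_compose adjoint_pair_cscale TS)
    also have "\<dots> = cscale_blinfun (cnj z) o\<^sub>L S"
      by (rule blinfun_eqI) (simp add: adjoint_pair_cscale_commute[OF adjoint_pair_sym[OF TS]])
    finally show "adjoint (cscale_blinfun z o\<^sub>L T) = cscale_blinfun (cnj z) o\<^sub>L adjoint T"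
      by (simp add: adjoint_eq[OF TS])
  qed
  show "norm (star a * a) = (norm a)\<^sup>2"
  proof (transfer, elim exE)
    fix T S :: "'a \<Rightarrow>\<^sub>L 'a" assume TS: "adjoint_pair T S"
    have "norm T \<le> sqrt (norm (S o\<^sub>L T))"
    proof (rule norm_blinfun_bound)
      fix y
      have "(norm (T y))\<^sup>2 = norm (star y * (S o\<^sub>L T) y)"
        using cstar_identity[of "T y"] adjoint_pairD[OF TS, of y "T y"] by simp
      also have "\<dots> \<le> norm y * norm ((S o\<^sub>L T) y)"
        using norm_mult_ineq[of "star y" "(S o\<^sub>L T) y"] by simp
      also have "\<dots> \<le> norm y * (norm (S o\<^sub>L T) * norm y)"
        by (intro mult_left_mono norm_blinfun) simp
      also have "\<dots> = (sqrt (norm (S o\<^sub>L T)) * norm y)\<^sup>2"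
        by (simp add: power_mult_distrib power2_eq_square)
      finally show "norm (T y) \<le> sqrt (norm (S o\<^sub>L T)) * norm y"
        by (rule power2_le_imp_le) simp
    qed simp
    then have "(norm T)\<^sup>2 \<le> (sqrt (norm (S o\<^sub>L T)))\<^sup>2" by (rule power_mono) simp
    then have "(norm T)\<^sup>2 \<le> norm (S o\<^sub>L T)" by simp
    moreover have "norm (S o\<^sub>L T) \<le> (norm T)\<^sup>2"
      using norm_blinfun_compose[of S T] adjoint_pair_norm[OF TS] by (simp add: power2_eq_square)
    ultimately show "norm (adjoint T o\<^sub>L T) = (norm T)\<^sup>2" by (simp add: adjoint_eq[OF TS])
  qed
qed

end

lift_definition left_mult :: "'a::cstar_algebra \<Rightarrow> 'a multiplier" is "\<lambda>x. Blinfun (\<lambda>y. x * y)"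
proof
  show "adjoint_pair (Blinfun (\<lambda>y. x * y)) (Blinfun (\<lambda>y. star x * y))" for x :: 'a
    by (simp add: adjoint_pair_def bounded_linear_Blinfun_apply bounded_linear_mult_right star_mult mult.assoc)
qed

lemma left_mult_add: "left_mult (x + y) = left_mult x + left_mult y"
  by transfer (rule blinfun_eqI, simp add: blinfun.bilinear_simps bounded_linear_Blinfun_apply bounded_linear_mult_right distrib_right)

lemma left_mult_scaleR: "left_mult (r *\<^sub>R x) = r *\<^sub>R left_mult x"
  by transfer (rule blinfun_eqI, simp add: blinfun.bilinear_simps bounded_linear_Blinfun_apply bounded_linear_mult_right)

lemma left_mult_diff: "left_mult (x - y) = left_mult x - left_mult y"
  by transfer (rule blinfun_eqI, simp add: blinfun.bilinear_simps bounded_linear_Blinfun_apply bounded_linear_mult_right left_diff_distrib)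

lemma left_mult_mult: "left_mult (x * y) = left_mult x * left_mult y"
  by transfer (rule blinfun_eqI, simp add: bounded_linear_Blinfun_apply bounded_linear_mult_right mult.assoc)

lemma left_mult_star: "left_mult (star x) = star (left_mult x)"
proof (transfer, rule sym, rule adjoint_eq)
  fix x :: 'a
  show "adjoint_pair (Blinfun (\<lambda>y. x * y)) (Blinfun (\<lambda>y. star x * y))"
    by (simp add: adjoint_pair_def bounded_linear_Blinfun_apply bounded_linear_mult_right star_mult mult.assoc)
qed

lemma norm_left_mult: "norm (left_mult x) = norm x"
proof (transfer, rule antisym)
  fix x :: 'a
  show "norm (Blinfun (\<lambda>y. x * y)) \<le> norm x"
    by (rule norm_blinfun_bound) (simp_all add: bounded_linear_Blinfun_apply bounded_linear_mult_right norm_mult_ineq)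
  show "norm x \<le> norm (Blinfun (\<lambda>y. x * y))"
  proof (cases "x = 0")
    case False
    have "norm x * norm x = norm (Blinfun (\<lambda>y. x * y) (star x))"
      using cstar_identity[of "star x"]
      by (simp add: bounded_linear_Blinfun_apply bounded_linear_mult_right star_star power2_eq_square)
    also have "\<dots> \<le> norm (Blinfun (\<lambda>y. x * y)) * norm x"
      using norm_blinfun[of "Blinfun (\<lambda>y. x * y)" "star x"] by simp
    finally show ?thesis using False by simp
  qed simp
qed

section \<open>The Hahn-Banach theorem\<close>

text \<open>
  Linear functionals on subspaces are represented by their graphs, and $M$ is such a graph below
  $p$.  A value $a$ at $x_0$ keeps the extended graph below $p$ if it lies between all
  $s - p (y - x_0)$ and all $p (y + x_0) - s$ with $(y, s) \in M$; sublinearity puts the former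
  below the latter, and $a$ is the supremum of the former.
\<close>

lemma sublinear_graph_extension:
  fixes p :: "'v::real_vector \<Rightarrow> real" and M :: "('v \<times> real) set"
  assumes subadd: "\<And>x y. p (x + y) \<le> p x + p y"
    and homog: "\<And>t x. t \<ge> 0 \<Longrightarrow> p (t *\<^sub>R x) = t * p x"
    and M: "subspace M" and dom: "\<And>x r. (x, r) \<in> M \<Longrightarrow> r \<le> p x"
  shows "\<exists>M' a. subspace M' \<and> M \<subseteq> M' \<and> (x0, a) \<in> M' \<and> (\<forall>(x, r)\<in>M'. r \<le> p x)"
proof -
  have M0: "(0, 0) \<in> M" using subspace_0[OF M] by (simp add: zero_prod_def)
  define B where "B = {s - p (y - x0) | y s. (y, s) \<in> M}"
  define a where "a = Sup B"
  have bound: "s - p (y - x0) \<le> p (y' + x0) - s'" if "(y, s) \<in> M" "(y', s') \<in> M" for y s y' s'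
  proof -
    have "(y + y', s + s') \<in> M" using subspace_add[OF M that] by simp
    then have "s + s' \<le> p ((y - x0) + (y' + x0))" using dom by simp
    also have "\<dots> \<le> p (y - x0) + p (y' + x0)" by (rule subadd)
    finally show ?thesis by simp
  qed
  have B0: "B \<noteq> {}" using M0 by (auto simp: B_def)
  have upper: "a \<le> p (y + x0) - s" if "(y, s) \<in> M" for y s
    unfolding a_def by (rule cSup_least[OF B0]) (use bound that in \<open>auto simp: B_def\<close>)
  have "bdd_above B" by (rule bdd_aboveI[of _ "p (0 + x0) - 0"]) (use bound[OF _ M0] in \<open>auto simp: B_def\<close>)
  then have lower: "s - p (y - x0) \<le> a" if "(y, s) \<in> M" for y s
    unfolding a_def by (intro cSup_upper) (use that in \<open>auto simp: B_def\<close>)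
  define M' where "M' = {z + t *\<^sub>R (x0, a) | z t. z \<in> M}"
  have "subspace M'"
  proof (rule subspaceI)
    have "0 = 0 + 0 *\<^sub>R (x0, a)" by (simp add: zero_prod_def)
    then show "0 \<in> M'" unfolding M'_def using subspace_0[OF M] by blast
  next
    fix u v assume "u \<in> M'" "v \<in> M'"
    then obtain z t z' t' where "z \<in> M" "z' \<in> M" "u = z + t *\<^sub>R (x0, a)" "v = z' + t' *\<^sub>R (x0, a)"
      unfolding M'_def by blast
    then have "u + v = (z + z') + (t + t') *\<^sub>R (x0, a)" "z + z' \<in> M"
      by (simp_all add: scaleR_add_left add_ac subspace_add[OF M] del: scaleR_Pair)
    then show "u + v \<in> M'" unfolding M'_def by blast
  next
    fix u and c :: real assume "u \<in> M'"
    then obtain z t where "z \<in> M" "u = z + t *\<^sub>R (x0, a)" unfolding M'_def by blast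
    then have "c *\<^sub>R u = c *\<^sub>R z + (c * t) *\<^sub>R (x0, a)" "c *\<^sub>R z \<in> M"
      by (simp_all add: scaleR_add_right subspace_scale[OF M] del: scaleR_Pair)
    then show "c *\<^sub>R u \<in> M'" unfolding M'_def by blast
  qed
  moreover have "M \<subseteq> M'"
  proof
    fix z assume "z \<in> M"
    moreover have "z = z + 0 *\<^sub>R (x0, a)" by (simp flip: zero_prod_def)
    ultimately show "z \<in> M'" unfolding M'_def by blast
  qed
  moreover have "(x0, a) \<in> M'"
  proof -
    have "(x0, a) = (0, 0) + 1 *\<^sub>R (x0, a)" by simp
    then show ?thesis unfolding M'_def using M0 by blast
  qed
  moreover have "r \<le> p x" if xr: "(x, r) \<in> M'" for x r
  proof -
    obtain y s t where ys: "(y, s) \<in> M" and x: "x = y + t *\<^sub>R x0" and r: "r = s + t * a"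
      using xr unfolding M'_def by auto
    consider "t = 0" | "t > 0" | "t < 0" by linarith
    then show ?thesis
    proof cases
      case 1
      then show ?thesis using dom ys x r by simp
    next
      case 2
      have "((1/t) *\<^sub>R y, s / t) \<in> M" using subspace_scale[OF M ys, of "1/t"] by simp
      from upper[OF this] have "s / t + a \<le> p ((1/t) *\<^sub>R y + x0)" by simp
      then have "t * (s / t + a) \<le> t * p ((1/t) *\<^sub>R y + x0)" using 2 by (intro mult_left_mono) auto
      also have "t * p ((1/t) *\<^sub>R y + x0) = p x" using 2 by (simp add: x scaleR_add_right flip: homog)
      finally show ?thesis using 2 by (simp add: r algebra_simps)
    next
      case 3
      have "((1/(-t)) *\<^sub>R y, s / (-t)) \<in> M" using subspace_scale[OF M ys, of "1/(-t)"] by simp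
      from lower[OF this] have "s / (-t) - a \<le> p ((1/(-t)) *\<^sub>R y - x0)" by simp
      then have "(-t) * (s / (-t) - a) \<le> (-t) * p ((1/(-t)) *\<^sub>R y - x0)" using 3 by (intro mult_left_mono) auto
      also have "(-t) * p ((1/(-t)) *\<^sub>R y - x0) = p ((-t) *\<^sub>R ((1/(-t)) *\<^sub>R y - x0))"
        using 3 by (intro homog[symmetric]) simp
      also have "(-t) *\<^sub>R ((1/(-t)) *\<^sub>R y - x0) = x" using 3 by (simp add: x scaleR_diff_right)
      finally show ?thesis using 3 by (simp add: r algebra_simps)
    qed
  qed
  ultimately show ?thesis by blast
qed

text \<open>
  A subspace below $p$ is automatically the graph of a function: $(0, r)$ and $(0, -r)$ in it give
  $r = 0$.  So Zorn's lemma applies to such subspaces ordered by inclusion, with no condition on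
  single values.
\<close>

theorem hahn_banach:
  fixes p :: "'v::real_vector \<Rightarrow> real"
  assumes subadd: "\<And>x y. p (x + y) \<le> p x + p y"
    and homog: "\<And>t x. t \<ge> 0 \<Longrightarrow> p (t *\<^sub>R x) = t * p x"
    and G: "subspace G" and dom: "\<And>x r. (x, r) \<in> G \<Longrightarrow> r \<le> p x"
  obtains F where "linear F" "\<And>x r. (x, r) \<in> G \<Longrightarrow> F x = r" "\<And>x. F x \<le> p x"
proof -
  define \<A> where "\<A> = {M. subspace M \<and> G \<subseteq> M \<and> (\<forall>(x, r)\<in>M. r \<le> p x)}"
  have "\<exists>M\<in>\<A>. \<forall>X\<in>\<A>. M \<subseteq> X \<longrightarrow> X = M"
  proof (rule subset_Zorn_nonempty)
    have "G \<in> \<A>" using G dom by (auto simp: \<A>_def)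
    then show "\<A> \<noteq> {}" by blast
    fix \<C> assume C0: "\<C> \<noteq> {}" and chain: "subset.chain \<A> \<C>"
    have CA: "M \<in> \<A>" if "M \<in> \<C>" for M using chain that by (auto simp: subset_chain_def)
    have "subspace (\<Union>\<C>)"
    proof (rule subspaceI)
      show "0 \<in> \<Union>\<C>" using C0 CA subspace_0 by (fastforce simp: \<A>_def)
    next
      fix x y assume "x \<in> \<Union>\<C>" "y \<in> \<Union>\<C>"
      then obtain M N where MN: "M \<in> \<C>" "x \<in> M" "N \<in> \<C>" "y \<in> N" by blast
      then have "M \<subseteq> N \<or> N \<subseteq> M" using chain by (auto simp: subset_chain_def)
      then obtain P where "P \<in> \<C>" "x \<in> P" "y \<in> P" using MN by blast
      moreover from this have "subspace P" using CA by (simp add: \<A>_def)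
      ultimately show "x + y \<in> \<Union>\<C>" using subspace_add by blast
    next
      fix c :: real and x assume "x \<in> \<Union>\<C>"
      then obtain M where "M \<in> \<C>" "x \<in> M" by blast
      moreover from this have "subspace M" using CA by (simp add: \<A>_def)
      ultimately show "c *\<^sub>R x \<in> \<Union>\<C>" using subspace_scale by blast
    qed
    moreover have "G \<subseteq> \<Union>\<C>" using C0 CA by (fastforce simp: \<A>_def)
    moreover have "\<forall>(x, r)\<in>\<Union>\<C>. r \<le> p x" using CA by (fastforce simp: \<A>_def)
    ultimately show "\<Union>\<C> \<in> \<A>" by (simp add: \<A>_def)
  qed
  then obtain M where M: "M \<in> \<A>" and max: "\<And>X. X \<in> \<A> \<Longrightarrow> M \<subseteq> X \<Longrightarrow> X = M" by blast
  have sM: "subspace M" and GM: "G \<subseteq> M" and domM: "\<And>x r. (x, r) \<in> M \<Longrightarrow> r \<le> p x"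
    using M by (auto simp: \<A>_def)
  have total: "\<exists>a. (x, a) \<in> M" for x
  proof -
    obtain M' a where M': "subspace M'" "M \<subseteq> M'" "(x, a) \<in> M'" "\<forall>(x, r)\<in>M'. r \<le> p x"
      using sublinear_graph_extension[OF subadd homog sM domM, of x] by blast
    then have "M' = M" using GM by (intro max) (auto simp: \<A>_def)
    with M' show ?thesis by blast
  qed
  have p0: "p 0 = 0" using homog[of 0 0] by simp
  have single: "r = s" if "(x, r) \<in> M" "(x, s) \<in> M" for x r s
  proof -
    have "r - s \<le> 0" using domM[of 0 "r - s"] subspace_diff[OF sM that] p0 by simp
    moreover have "s - r \<le> 0" using domM[of 0 "s - r"] subspace_diff[OF sM that(2) that(1)] p0 by simp
    ultimately show ?thesis by simp
  qed
  define F where "F x = (THE r. (x, r) \<in> M)" for x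
  have FM: "(x, F x) \<in> M" for x
    unfolding F_def by (rule theI') (use total single in blast)
  have FI: "F x = r" if "(x, r) \<in> M" for x r using single FM that by blast
  have "linear F"
  proof (rule linearI)
    show "F (x + y) = F x + F y" for x y using subspace_add[OF sM FM FM, of x y] by (simp add: FI)
    show "F (c *\<^sub>R x) = c *\<^sub>R F x" for c x using subspace_scale[OF sM FM, of c x] by (simp add: FI)
  qed
  with FI GM domM FM that show ?thesis by blast
qed

section \<open>Jordan decomposition on star-subspaces\<close>

definition pos_elem :: "'a::cstar_algebra \<Rightarrow> bool" where
  "pos_elem c \<longleftrightarrow> pos (left_mult c)"

lemma pos_elem_zero [simp]: "pos_elem (0::'a::cstar_algebra)"
  using left_mult_scaleR[of 0 "0::'a"] by (simp add: pos_elem_def)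

lemma pos_elem_add: "pos_elem c \<Longrightarrow> pos_elem d \<Longrightarrow> pos_elem (c + d)"
  by (simp add: pos_elem_def left_mult_add pos_add)

lemma pos_elem_scaleR: "pos_elem c \<Longrightarrow> t \<ge> 0 \<Longrightarrow> pos_elem (t *\<^sub>R c)"
  by (simp add: pos_elem_def left_mult_scaleR pos_scaleR)

lemma pos_elem_star_mult: "pos_elem (star y * y)"
  by (simp add: pos_elem_def left_mult_mult left_mult_star pos_star_mult_self)

text \<open>
  In terms of the gauge defined next: on the antidiagonal the gauge is at least the norm.
\<close>

lemma norm_le_max_of_pos_elem:
  assumes "star x = x" "pos_elem c" "pos_elem d"
  shows "norm x \<le> max (norm (x + c)) (norm (- x + d))"
proof -
  have "norm (left_mult x) \<le> max (norm (x + c)) (norm (- x + d))"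
  proof (rule norm_le_of_order_bounds)
    show "star (left_mult x) = left_mult x" using assms by (simp flip: left_mult_star)
    show "norm (left_mult x + left_mult c) \<le> max (norm (x + c)) (norm (- x + d))"
      by (simp add: norm_left_mult flip: left_mult_add)
    have "norm (x - d) = norm (- x + d)" by (metis minus_diff_eq norm_minus_cancel uminus_add_conv_diff)
    then show "norm (left_mult x - left_mult d) \<le> max (norm (x + c)) (norm (- x + d))"
      by (simp add: norm_left_mult flip: left_mult_diff)
  qed (use assms in \<open>simp_all add: pos_elem_def\<close>)
  then show ?thesis by (simp add: norm_left_mult)
qed

text \<open>
  This is the largest sublinear functional on pairs that is at most $\max (\|a\|, \|b\|)$ at $(a, b)$ and at
  most 0 at $(-c, -d)$ for positive $c, d$.  The linear functionals below it are the pairs of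
  positive functionals with norms adding up to at most 1.
\<close>

definition order_gauge :: "'a::cstar_algebra \<times> 'a \<Rightarrow> real" where
  "order_gauge z = (INF w\<in>{(c, d). pos_elem c \<and> pos_elem d}. max (norm (fst z + fst w)) (norm (snd z + snd w)))"

lemma order_gauge_le:
  "pos_elem c \<Longrightarrow> pos_elem d \<Longrightarrow> order_gauge (a, b) \<le> max (norm (a + c)) (norm (b + d))"
  unfolding order_gauge_def
  by (rule cINF_lower2[where x="(c, d)"]) (auto intro!: bdd_belowI[of _ 0] simp: le_max_iff_disj)

lemma order_gauge_greatest:
  assumes "\<And>c d. pos_elem c \<Longrightarrow> pos_elem d \<Longrightarrow> r \<le> max (norm (a + c)) (norm (b + d))"
  shows "r \<le> order_gauge (a, b)"
  unfolding order_gauge_def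
proof (rule cINF_greatest)
  have "(0, 0) \<in> {(c, d). pos_elem c \<and> pos_elem (d::'a)}" by simp
  then show "{(c, d). pos_elem c \<and> pos_elem (d::'a)} \<noteq> {}" by blast
qed (use assms in auto)

lemma order_gauge_nonneg: "0 \<le> order_gauge z"
  by (cases z) (auto intro!: order_gauge_greatest simp: le_max_iff_disj)

lemma order_gauge_add: "order_gauge (z + w) \<le> order_gauge z + order_gauge w"
proof (cases z, cases w)
  fix a b a' b' :: 'a assume z: "z = (a, b)" and w: "w = (a', b')"
  have "order_gauge (z + w) - order_gauge w \<le> order_gauge (a, b)"
  proof (rule order_gauge_greatest)
    fix c d :: 'a assume cd: "pos_elem c" "pos_elem d"
    have "order_gauge (z + w) - max (norm (a + c)) (norm (b + d)) \<le> order_gauge (a', b')"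
    proof (rule order_gauge_greatest)
      fix c' d' :: 'a assume cd': "pos_elem c'" "pos_elem d'"
      have "order_gauge (z + w) \<le> max (norm ((a + a') + (c + c'))) (norm ((b + b') + (d + d')))"
        unfolding z w using cd cd' by (simp add: order_gauge_le pos_elem_add)
      moreover have "norm ((a + a') + (c + c')) \<le> norm (a + c) + norm (a' + c')"
        using norm_triangle_ineq[of "a + c" "a' + c'"] by (simp add: add_ac)
      moreover have "norm ((b + b') + (d + d')) \<le> norm (b + d) + norm (b' + d')"
        using norm_triangle_ineq[of "b + d" "b' + d'"] by (simp add: add_ac)
      ultimately show "order_gauge (z + w) - max (norm (a + c)) (norm (b + d)) \<le> max (norm (a' + c')) (norm (b' + d'))"
        by linarith
    qed
    then show "order_gauge (z + w) - order_gauge w \<le> max (norm (a + c)) (norm (b + d))" by (simp add: w)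
  qed
  then show ?thesis by (simp add: z)
qed

lemma order_gauge_scaleR:
  assumes "t \<ge> 0" shows "order_gauge (t *\<^sub>R z) = t * order_gauge z"
proof -
  have le: "t * order_gauge z \<le> order_gauge (t *\<^sub>R z)" if t: "t > 0" for t and z :: "'a \<times> 'a"
  proof (cases z)
    case (Pair a b)
    have "t * order_gauge z \<le> order_gauge (t *\<^sub>R a, t *\<^sub>R b)"
    proof (rule order_gauge_greatest)
      fix c d :: 'a assume cd: "pos_elem c" "pos_elem d"
      have "order_gauge z \<le> max (norm (a + (1/t) *\<^sub>R c)) (norm (b + (1/t) *\<^sub>R d))"
        unfolding Pair using cd t by (simp add: order_gauge_le pos_elem_scaleR)
      then have "t * order_gauge z \<le> t * max (norm (a + (1/t) *\<^sub>R c)) (norm (b + (1/t) *\<^sub>R d))"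
        using t by (intro mult_left_mono) auto
      also have "\<dots> = max (t * norm (a + (1/t) *\<^sub>R c)) (t * norm (b + (1/t) *\<^sub>R d))"
        using t by (simp add: max_mult_distrib_left)
      also have "t * norm (a + (1/t) *\<^sub>R c) = norm (t *\<^sub>R (a + (1/t) *\<^sub>R c))" using t by simp
      also have "t * norm (b + (1/t) *\<^sub>R d) = norm (t *\<^sub>R (b + (1/t) *\<^sub>R d))" using t by simp
      finally show "t * order_gauge z \<le> max (norm (t *\<^sub>R a + c)) (norm (t *\<^sub>R b + d))"
        using t by (simp add: scaleR_add_right)
    qed
    then show ?thesis by (simp add: Pair)
  qed
  show ?thesis
  proof (cases "t = 0")
    case True
    have "order_gauge (0::'a, 0::'a) \<le> 0" using order_gauge_le[of 0 0 0 0] by simp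
    then show ?thesis using True order_gauge_nonneg[of "(0::'a, 0::'a)"] by (simp add: zero_prod_def)
  next
    case False
    with assms have t: "t > 0" by simp
    have "(1/t) * order_gauge (t *\<^sub>R z) \<le> order_gauge z"
      using le[of "1/t" "t *\<^sub>R z"] t by simp
    then have "order_gauge (t *\<^sub>R z) \<le> t * order_gauge z" using t by (simp add: field_simps)
    with le[OF t, of z] show ?thesis by simp
  qed
qed

definition real_part :: "'a::cstar_algebra \<Rightarrow> 'a" where
  "real_part x = (1/2) *\<^sub>R (x + star x)"

lemma real_part_add: "real_part (x + y) = real_part x + real_part y"
  by (simp add: real_part_def star_add algebra_simps)

lemma real_part_scaleR: "real_part (r *\<^sub>R x) = r *\<^sub>R real_part x"
  by (simp add: real_part_def algebra_simps)

lemma star_real_part: "star (real_part x) = real_part x"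
  by (simp add: real_part_def star_add star_star add.commute)

lemma norm_real_part: "norm (real_part x) \<le> norm x"
  using norm_triangle_ineq[of x "star x"] by (simp add: real_part_def)

lemma real_part_selfadj: "star x = x \<Longrightarrow> real_part x = x"
  by (simp add: real_part_def flip: scaleR_2)

text \<open>
  The complex-linear functional whose real part is \<open>g\<close> composed with \<open>real_part\<close>.
\<close>

definition complexify :: "('a::cstar_algebra \<Rightarrow> real) \<Rightarrow> 'a \<Rightarrow> complex" where
  "complexify g x = Complex (g (real_part x)) (- g (real_part (cscale \<i> x)))"

lemma cscale_eq: "cscale c x = Re c *\<^sub>R x + Im c *\<^sub>R cscale \<i> x"
proof -
  have "cscale c x = cscale (complex_of_real (Re c) + complex_of_real (Im c) * \<i>) x"
    using complex_eq[of c] by (simp add: mult.commute)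
  also have "\<dots> = Re c *\<^sub>R x + Im c *\<^sub>R cscale \<i> x"
    by (simp add: cscale_add_left cscale_of_real flip: cscale_cscale)
  finally show ?thesis .
qed

lemma complexify_add:
  assumes "linear g" shows "complexify g (x + y) = complexify g x + complexify g y"
  using assms by (simp add: complexify_def cscale_add_right real_part_add linear_add complex_eq_iff)

lemma complexify_cscale:
  assumes "linear g" shows "complexify g (cscale c x) = c * complexify g x"
proof -
  have 1: "g (real_part (cscale c x)) = Re c * g (real_part x) + Im c * g (real_part (cscale \<i> x))" for c x
    using assms by (subst cscale_eq) (simp add: real_part_add real_part_scaleR linear_add linear_scale)
  show ?thesis
    using 1[of c x] 1[of "\<i> * c" x] by (simp add: complexify_def complex_eq_iff cscale_cscale)
qed

text \<open>
  Rotating the argument turns the absolute value into a real part; so norm estimates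
  for \<open>g\<close> on self-adjoint elements carry over to \<open>complexify g\<close>.
\<close>

lemma complexify_unimodular:
  assumes "linear g" shows "\<exists>\<theta>. cmod \<theta> = 1 \<and> g (real_part (cscale \<theta> x)) = cmod (complexify g x)"
proof -
  define z where "z = complexify g x"
  define \<theta> where "\<theta> = (if z = 0 then 1 else cnj z / complex_of_real (cmod z))"
  have "cmod \<theta> = 1" by (simp add: \<theta>_def norm_divide)
  moreover have "\<theta> * z = complex_of_real (cmod z)"
    by (auto simp: \<theta>_def complex_norm_square power2_eq_square field_simps simp flip: of_real_mult)
      (metis complex_norm_square mult.commute of_real_mult power2_eq_square)
  then have "complexify g (cscale \<theta> x) = complex_of_real (cmod z)"
    by (simp add: complexify_cscale[OF assms] z_def)
  then have "g (real_part (cscale \<theta> x)) = cmod z"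
    by (simp add: complexify_def complex_eq_iff)
  ultimately show ?thesis unfolding z_def by blast
qed

text \<open>
  The norm estimate is stated for two independent arguments.  It therefore bounds the sum of the two
  suprema, that is, of the norms of \<open>\<phi>p\<close> and \<open>\<phi>m\<close>, and not merely the supremum of the sum.
\<close>

theorem jordan_decomposition_star_subspace:
  fixes V :: "'a::cstar_algebra set" and \<phi> :: "'a \<Rightarrow> complex" and D :: real
  assumes V: "star_subspace V"
    and add: "\<And>x y. x \<in> V \<Longrightarrow> y \<in> V \<Longrightarrow> \<phi> (x + y) = \<phi> x + \<phi> y"
    and scale: "\<And>c x. x \<in> V \<Longrightarrow> \<phi> (cscale c x) = c * \<phi> x"
    and herm: "\<And>x. x \<in> V \<Longrightarrow> \<phi> (star x) = cnj (\<phi> x)"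
    and D: "D \<ge> 0" and bound: "\<And>x. x \<in> V \<Longrightarrow> cmod (\<phi> x) \<le> D * norm x"
  obtains \<phi>p \<phi>m :: "'a \<Rightarrow> complex"
  where "\<And>x y. \<phi>p (x + y) = \<phi>p x + \<phi>p y" "\<And>c x. \<phi>p (cscale c x) = c * \<phi>p x"
    and "\<And>y. \<phi>p (star y * y) \<in> \<real>\<^sub>\<ge>\<^sub>0"
    and "\<And>x y. \<phi>m (x + y) = \<phi>m x + \<phi>m y" "\<And>c x. \<phi>m (cscale c x) = c * \<phi>m x"
    and "\<And>y. \<phi>m (star y * y) \<in> \<real>\<^sub>\<ge>\<^sub>0"
    and "\<And>x. x \<in> V \<Longrightarrow> \<phi> x = \<phi>p x - \<phi>m x"
    and "\<And>x y. norm x \<le> 1 \<Longrightarrow> norm y \<le> 1 \<Longrightarrow> cmod (\<phi>p x) + cmod (\<phi>m y) \<le> D"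
proof -
  have V0: "0 \<in> V" and Vadd: "\<And>x y. x \<in> V \<Longrightarrow> y \<in> V \<Longrightarrow> x + y \<in> V"
    and Vsc: "\<And>c x. x \<in> V \<Longrightarrow> cscale c x \<in> V" and Vst: "\<And>x. x \<in> V \<Longrightarrow> star x \<in> V"
    using V by (auto simp: star_subspace_def)
  have VscR: "r *\<^sub>R x \<in> V" if "x \<in> V" for r x using Vsc[OF that, of "complex_of_real r"] by (simp add: cscale_of_real)
  have scaleR: "\<phi> (r *\<^sub>R x) = complex_of_real r * \<phi> x" if "x \<in> V" for r x
    using scale[OF that, of "complex_of_real r"] by (simp add: cscale_of_real)
  have phi0: "\<phi> 0 = 0" using scale[OF V0, of 0] by simp
  \<comment> \<open>The graph of the functional on the antidiagonal that is to be extended.\<close>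
  define G where "G = {((x, - x), Re (\<phi> x)) | x. x \<in> V \<and> star x = x}"
  have "subspace G"
  proof (rule subspaceI)
    have "(0::('a \<times> 'a) \<times> real) = ((0, - 0), Re (\<phi> 0))" by (simp add: phi0 zero_prod_def)
    then show "0 \<in> G" unfolding G_def using V0 star_zero by blast
  next
    fix u v assume "u \<in> G" "v \<in> G"
    then obtain x y where x: "x \<in> V" "star x = x" "u = ((x, - x), Re (\<phi> x))"
      and y: "y \<in> V" "star y = y" "v = ((y, - y), Re (\<phi> y))" unfolding G_def by blast
    have "u + v = ((x + y, - (x + y)), Re (\<phi> (x + y)))" using x y by (simp add: add)
    moreover have "x + y \<in> V" "star (x + y) = x + y" using x y by (simp_all add: Vadd star_add)
    ultimately show "u + v \<in> G" unfolding G_def by blast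
  next
    fix c :: real and u assume "u \<in> G"
    then obtain x where x: "x \<in> V" "star x = x" "u = ((x, - x), Re (\<phi> x))" unfolding G_def by blast
    have "c *\<^sub>R u = ((c *\<^sub>R x, - (c *\<^sub>R x)), Re (\<phi> (c *\<^sub>R x)))" using x by (simp add: scaleR)
    moreover have "c *\<^sub>R x \<in> V" "star (c *\<^sub>R x) = c *\<^sub>R x" using x by (simp_all add: VscR)
    ultimately show "c *\<^sub>R u \<in> G" unfolding G_def by blast
  qed
  moreover have "r \<le> D * order_gauge z" if "(z, r) \<in> G" for z r
  proof -
    obtain x where x: "x \<in> V" "star x = x" "z = (x, - x)" "r = Re (\<phi> x)" using \<open>(z, r) \<in> G\<close> unfolding G_def by blast
    have "norm x \<le> order_gauge (x, - x)"
      using x(2) by (intro order_gauge_greatest norm_le_max_of_pos_elem)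
    then have "D * norm x \<le> D * order_gauge (x, - x)" using D by (rule mult_left_mono)
    with bound[OF x(1)] complex_Re_le_cmod[of "\<phi> x"] show ?thesis by (simp add: x(3,4))
  qed
  moreover have "D * order_gauge (z + w) \<le> D * order_gauge z + D * order_gauge w" for z w :: "'a \<times> 'a"
    using mult_left_mono[OF order_gauge_add D] by (simp add: distrib_left)
  moreover have "D * order_gauge (t *\<^sub>R z) = t * (D * order_gauge z)" if "t \<ge> 0" for t and z :: "'a \<times> 'a"
    using that by (simp add: order_gauge_scaleR)
  ultimately obtain F where F: "linear F" and FG: "\<And>x r. (x, r) \<in> G \<Longrightarrow> F x = r"
    and Fle: "\<And>x. F x \<le> D * order_gauge x"
    using hahn_banach[of "\<lambda>z. D * order_gauge z" G] by blast
  define g1 g2 where "g1 a = F (a, 0)" and "g2 a = F (0, a)" for a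
  have l1: "linear g1" and l2: "linear g2"
    using linear_add[OF F, of "(_, 0)" "(_, 0)"] linear_scale[OF F, of _ "(_, 0)"]
      linear_add[OF F, of "(0, _)" "(0, _)"] linear_scale[OF F, of _ "(0, _)"]
    by (auto intro!: linearI simp: g1_def g2_def)
  have Fg: "F (a, b) = g1 a + g2 b" for a b
    using linear_add[OF F, of "(a, 0)" "(0, b)"] by (simp add: g1_def g2_def)
  have gpos: "g1 c \<ge> 0" "g2 c \<ge> 0" if c: "pos_elem c" for c
  proof -
    have "order_gauge (- c, 0) \<le> 0" "order_gauge (0, - c) \<le> 0"
      using order_gauge_le[OF c pos_elem_zero, of "- c" 0] order_gauge_le[OF pos_elem_zero c, of 0 "- c"] by simp_all
    then have "F (- c, 0) \<le> 0" "F (0, - c) \<le> 0"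
      using Fle[of "(- c, 0)"] Fle[of "(0, - c)"] D by (meson mult_nonneg_nonpos order_trans)+
    then show "g1 c \<ge> 0" "g2 c \<ge> 0"
      using linear_neg[OF l1, of c] linear_neg[OF l2, of c] linear_0[OF l1] linear_0[OF l2] by (simp_all add: Fg)
  qed
  have cpos: "complexify g (star y * y) \<in> \<real>\<^sub>\<ge>\<^sub>0" if g: "linear g" "\<And>c. pos_elem c \<Longrightarrow> g c \<ge> 0" for g y
  proof -
    have g0: "g 0 = 0" using linear_scale[OF g(1), of 0 0] by simp
    have "star (star y * y) = star y * y" by (simp add: star_mult star_star)
    moreover from this have "real_part (cscale \<i> (star y * y)) = 0"
      by (simp add: real_part_def star_cscale cscale_minus_left)
    ultimately show ?thesis
      using g(2)[OF pos_elem_star_mult[of y]] g0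
      by (simp add: complexify_def real_part_selfadj complex_nonneg_Reals_iff)
  qed
  have ph: "g1 (real_part x) - g2 (real_part x) = Re (\<phi> x)" if x: "x \<in> V" for x
  proof -
    have rV: "real_part x \<in> V" using x by (simp add: real_part_def VscR Vadd Vst)
    have "\<phi> (real_part x) = complex_of_real (1/2) * (\<phi> x + cnj (\<phi> x))"
      using x by (simp add: real_part_def scaleR add herm Vadd Vst del: of_real_divide)
    then have "Re (\<phi> (real_part x)) = Re (\<phi> x)" by (simp only:) simp
    moreover have "F (real_part x, - real_part x) = Re (\<phi> (real_part x))"
      using rV star_real_part by (intro FG) (auto simp: G_def)
    ultimately show ?thesis using linear_neg[OF l2] by (simp add: Fg)
  qed
  have dec: "\<phi> x = complexify g1 x - complexify g2 x" if x: "x \<in> V" for x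
    using ph[OF x] ph[OF Vsc[OF x, of \<i>]] scale[OF x, of \<i>]
    by (simp add: complexify_def complex_eq_iff)
  have nb: "cmod (complexify g1 x) + cmod (complexify g2 y) \<le> D" if "norm x \<le> 1" "norm y \<le> 1" for x y
  proof -
    obtain \<theta> \<eta> where t: "cmod \<theta> = 1" "g1 (real_part (cscale \<theta> x)) = cmod (complexify g1 x)"
      and e: "cmod \<eta> = 1" "g2 (real_part (cscale \<eta> y)) = cmod (complexify g2 y)"
      using complexify_unimodular[OF l1] complexify_unimodular[OF l2] by metis
    define a b where "a = real_part (cscale \<theta> x)" and "b = real_part (cscale \<eta> y)"
    have "norm a \<le> 1" "norm b \<le> 1"
      using norm_real_part[of "cscale \<theta> x"] norm_real_part[of "cscale \<eta> y"] that t(1) e(1)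
      by (simp_all add: a_def b_def norm_cscale)
    then have "order_gauge (a, b) \<le> 1"
      using order_gauge_le[OF pos_elem_zero pos_elem_zero, of a b] by simp
    then have "D * order_gauge (a, b) \<le> D" using D by (simp add: mult_left_le)
    then have "F (a, b) \<le> D" using Fle[of "(a, b)"] by simp
    then show ?thesis using t e by (simp add: Fg a_def b_def)
  qed
  show ?thesis
    by (rule that[of "complexify g1" "complexify g2"])
      (use dec nb gpos cpos[OF l1] cpos[OF l2] complexify_add[OF l1] complexify_add[OF l2]
        complexify_cscale[OF l1] complexify_cscale[OF l2] in blast)+
qed

section \<open>The product of all matrix C*-algebras\<close>

lemma mat_cscale_carrier [simp]: "x \<in> carrier_mat m n \<Longrightarrow> mat_cscale c x \<in> carrier_mat m n"
  by (simp add: mat_cscale_def)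

lemma mat_star_carrier [simp]: "x \<in> carrier_mat m n \<Longrightarrow> mat_star x \<in> carrier_mat n m"
  by (simp add: mat_star_def)

lemma cscale_sum: "cscale c (sum f A) = (\<Sum>i\<in>A. cscale c (f i :: 'a::cstar_algebra))"
  by (induction A rule: infinite_finite_induct) (simp_all add: cscale_add_right)

lemma star_sum: "star (sum f A) = (\<Sum>i\<in>A. star (f i :: 'a::cstar_algebra))"
  by (induction A rule: infinite_finite_induct) (simp_all add: star_add)

lemma mat_cscale_add:
  "x \<in> carrier_mat m n \<Longrightarrow> y \<in> carrier_mat m n \<Longrightarrow> mat_cscale c (x + y) = mat_cscale c x + mat_cscale c y"
  by (rule eq_matI) (auto simp: mat_cscale_def cscale_add_right)

lemma mat_cscale_add_left: "mat_cscale (c + d) x = mat_cscale c x + mat_cscale d x"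
  by (rule eq_matI) (auto simp: mat_cscale_def cscale_add_left)

lemma mat_cscale_cscale: "mat_cscale c (mat_cscale d x) = mat_cscale (c * d) x"
  by (rule eq_matI) (auto simp: mat_cscale_def cscale_cscale)

lemma mat_cscale_one: "mat_cscale 1 x = x"
  by (rule eq_matI) (auto simp: mat_cscale_def)

lemma mat_cscale_minus_one: "mat_cscale (- 1) x = - x"
  by (rule eq_matI) (auto simp: mat_cscale_def cscale_minus_left)

lemma mat_cscale_mult_left:
  "x \<in> carrier_mat l m \<Longrightarrow> y \<in> carrier_mat m n \<Longrightarrow> mat_cscale c x * y = mat_cscale c (x * y)"
  by (rule eq_matI) (auto simp: mat_cscale_def scalar_prod_def cscale_sum cscale_mult_left)

lemma mat_cscale_mult_right:
  "x \<in> carrier_mat l m \<Longrightarrow> y \<in> carrier_mat m n \<Longrightarrow> x * mat_cscale c y = mat_cscale c (x * y)"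
  by (rule eq_matI) (auto simp: mat_cscale_def scalar_prod_def cscale_sum cscale_mult_right)

lemma mat_star_star [simp]: "mat_star (mat_star x) = x"
  by (rule eq_matI) (auto simp: mat_star_def star_star)

lemma mat_star_add:
  "x \<in> carrier_mat m n \<Longrightarrow> y \<in> carrier_mat m n \<Longrightarrow> mat_star (x + y) = mat_star x + mat_star y"
  by (rule eq_matI) (auto simp: mat_star_def star_add)

lemma mat_star_cscale: "mat_star (mat_cscale c x) = mat_cscale (cnj c) (mat_star x)"
  by (rule eq_matI) (auto simp: mat_star_def mat_cscale_def star_cscale)

lemma mat_star_mult:
  "x \<in> carrier_mat l m \<Longrightarrow> y \<in> carrier_mat m n \<Longrightarrow> mat_star (x * y) = mat_star y * mat_star x"
  by (rule eq_matI) (auto simp: mat_star_def scalar_prod_def star_sum star_mult)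

context
  fixes n :: nat and N :: "'a::cstar_algebra mat \<Rightarrow> real"
  assumes N: "mat_cstar_norm n N"
begin

lemma cstar_norm_nonneg: "x \<in> carrier_mat n n \<Longrightarrow> 0 \<le> N x"
  and cstar_norm_eq_0: "x \<in> carrier_mat n n \<Longrightarrow> N x = 0 \<longleftrightarrow> x = 0\<^sub>m n n"
  and cstar_norm_add: "x \<in> carrier_mat n n \<Longrightarrow> y \<in> carrier_mat n n \<Longrightarrow> N (x + y) \<le> N x + N y"
  and cstar_norm_cscale: "x \<in> carrier_mat n n \<Longrightarrow> N (mat_cscale c x) = cmod c * N x"
  and cstar_norm_mult: "x \<in> carrier_mat n n \<Longrightarrow> y \<in> carrier_mat n n \<Longrightarrow> N (x * y) \<le> N x * N y"
  and cstar_norm_cstar: "x \<in> carrier_mat n n \<Longrightarrow> N (mat_star x * x) = (N x)\<^sup>2"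
  using N by (auto simp: mat_cstar_norm_def)

lemma cstar_norm_complete:
  assumes "\<And>k. X k \<in> carrier_mat n n" "\<And>\<epsilon>. \<epsilon> > 0 \<Longrightarrow> \<exists>K. \<forall>k\<ge>K. \<forall>l\<ge>K. N (X k - X l) < \<epsilon>"
  shows "\<exists>x\<in>carrier_mat n n. (\<lambda>k. N (X k - x)) \<longlonglongrightarrow> 0"
  using N assms unfolding mat_cstar_norm_def by blast

lemma cstar_norm_zero: "N (0\<^sub>m n n) = 0"
  using cstar_norm_eq_0 by simp

lemma cstar_norm_minus: "x \<in> carrier_mat n n \<Longrightarrow> N (- x) = N x"
  using cstar_norm_cscale[of x "- 1"] by (simp add: mat_cscale_minus_one)

lemma cstar_norm_diff: "x \<in> carrier_mat n n \<Longrightarrow> y \<in> carrier_mat n n \<Longrightarrow> N (x - y) \<le> N x + N y"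
  using cstar_norm_add[of x "- y"] by (simp add: cstar_norm_minus minus_add_uminus_mat[of x n n y])

lemma cstar_norm_star: assumes x: "x \<in> carrier_mat n n" shows "N (mat_star x) = N x"
proof -
  have le: "N y \<le> N (mat_star y)" if y: "y \<in> carrier_mat n n" for y
  proof (cases "N y = 0")
    case True
    then show ?thesis using cstar_norm_nonneg y by simp
  next
    case False
    have "N y * N y \<le> N (mat_star y) * N y"
      using cstar_norm_mult[of "mat_star y" y] cstar_norm_cstar[of y] y by (simp add: power2_eq_square)
    then show ?thesis using False cstar_norm_nonneg[OF y] by simp
  qed
  show ?thesis using le[OF x] le[of "mat_star x"] x by simp
qed

end

text \<open>
  There is always a C*-norm in size 0, so the index type below is not empty.
\<close>

lemma mat_cstar_norm_0: "mat_cstar_norm 0 (\<lambda>x. 0)"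
  by (auto simp: mat_cstar_norm_def intro!: bexI[of _ "0\<^sub>m 0 0"])

text \<open>
  Every C*-norm on a matrix algebra is given its own index, even if two of them belong to the same
  size.  This allows two norms on the same algebra to be compared inside one C*-algebra.
\<close>

typedef (overloaded) 'a cstar_index = "{(n, N :: 'a::cstar_algebra mat \<Rightarrow> real). mat_cstar_norm n N}"
  using mat_cstar_norm_0 by blast

definition idim :: "'a::cstar_algebra cstar_index \<Rightarrow> nat" where
  "idim i = fst (Rep_cstar_index i)"

definition inorm :: "'a::cstar_algebra cstar_index \<Rightarrow> 'a mat \<Rightarrow> real" where
  "inorm i = snd (Rep_cstar_index i)"

abbreviation icarrier :: "'a::cstar_algebra cstar_index \<Rightarrow> 'a mat set" where
  "icarrier i \<equiv> carrier_mat (idim i) (idim i)"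

lemma mat_cstar_norm_inorm: "mat_cstar_norm (idim i) (inorm i)"
  using Rep_cstar_index[of i] by (simp add: idim_def inorm_def case_prod_unfold)

lemmas inorm_nonneg = cstar_norm_nonneg[OF mat_cstar_norm_inorm]
  and inorm_eq_0 = cstar_norm_eq_0[OF mat_cstar_norm_inorm]
  and inorm_add = cstar_norm_add[OF mat_cstar_norm_inorm]
  and inorm_cscale = cstar_norm_cscale[OF mat_cstar_norm_inorm]
  and inorm_mult = cstar_norm_mult[OF mat_cstar_norm_inorm]
  and inorm_cstar = cstar_norm_cstar[OF mat_cstar_norm_inorm]
  and inorm_complete = cstar_norm_complete[OF mat_cstar_norm_inorm]
  and inorm_zero = cstar_norm_zero[OF mat_cstar_norm_inorm]
  and inorm_diff = cstar_norm_diff[OF mat_cstar_norm_inorm]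
  and inorm_star = cstar_norm_star[OF mat_cstar_norm_inorm]

lemma cstar_index_exists:
  assumes "mat_cstar_norm n N" obtains i where "idim i = n" "inorm i = N"
proof
  show "idim (Abs_cstar_index (n, N)) = n" "inorm (Abs_cstar_index (n, N)) = N"
    using assms by (simp_all add: idim_def inorm_def Abs_cstar_index_inverse)
qed

text \<open>
  The bounded families form a C*-algebra under the supremum norm, with each matrix algebra,
  equipped with any of its C*-norms, as a star-subalgebra.
\<close>

definition bounded_family :: "('a::cstar_algebra cstar_index \<Rightarrow> 'a mat) \<Rightarrow> bool" where
  "bounded_family f \<longleftrightarrow> (\<forall>i. f i \<in> icarrier i) \<and> (\<exists>C. \<forall>i. inorm i (f i) \<le> C)"

lemma bounded_familyI: "(\<And>i. f i \<in> icarrier i) \<Longrightarrow> (\<And>i. inorm i (f i) \<le> C) \<Longrightarrow> bounded_family f"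
  by (auto simp: bounded_family_def)

lemma bounded_familyE:
  assumes "bounded_family f"
  obtains C where "C \<ge> 0" "\<And>i. f i \<in> icarrier i" "\<And>i. inorm i (f i) \<le> C"
  using assms inorm_nonneg order_trans unfolding bounded_family_def by blast

lemma bounded_family_carrier: "bounded_family f \<Longrightarrow> f i \<in> icarrier i"
  by (simp add: bounded_family_def)

lemma bounded_family_zero: "bounded_family (\<lambda>i. 0\<^sub>m (idim i) (idim i))"
  by (rule bounded_familyI[where C=0]) (simp_all add: inorm_zero)

lemma bounded_family_add:
  assumes "bounded_family f" "bounded_family g" shows "bounded_family (\<lambda>i. f i + g i)"
proof -
  obtain C D where "\<And>i. f i \<in> icarrier i" "\<And>i. inorm i (f i) \<le> C"
     "\<And>i. g i \<in> icarrier i" "\<And>i. inorm i (g i) \<le> D"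
    using assms by (metis bounded_familyE)
  then show ?thesis
    by (intro bounded_familyI[where C="C + D"]) (auto intro!: order_trans[OF inorm_add] add_mono)
qed

lemma bounded_family_cscale:
  assumes "bounded_family f" shows "bounded_family (\<lambda>i. mat_cscale c (f i))"
proof -
  obtain C where "\<And>i. f i \<in> icarrier i" "\<And>i. inorm i (f i) \<le> C"
    using assms by (metis bounded_familyE)
  then show ?thesis
    by (intro bounded_familyI[where C="cmod c * C"]) (auto simp: inorm_cscale intro: mult_left_mono)
qed

lemma bounded_family_minus: "bounded_family f \<Longrightarrow> bounded_family (\<lambda>i. - f i)"
  using bounded_family_cscale[of f "- 1"] by (simp add: mat_cscale_minus_one)

lemma bounded_family_diff:
  assumes "bounded_family f" "bounded_family g" shows "bounded_family (\<lambda>i. f i - g i)"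
proof -
  have "(\<lambda>i. f i - g i) = (\<lambda>i. f i + - g i)"
    using assms by (auto simp: minus_add_uminus_mat[OF bounded_family_carrier bounded_family_carrier])
  then show ?thesis using bounded_family_add[OF assms(1) bounded_family_minus[OF assms(2)]] by simp
qed

lemma bounded_family_mult:
  assumes "bounded_family f" "bounded_family g" shows "bounded_family (\<lambda>i. f i * g i)"
proof -
  obtain C where C: "C \<ge> 0" "\<And>i. f i \<in> icarrier i" "\<And>i. inorm i (f i) \<le> C"
    using bounded_familyE[OF assms(1)] by metis
  obtain D where D: "\<And>i. g i \<in> icarrier i" "\<And>i. inorm i (g i) \<le> D"
    using bounded_familyE[OF assms(2)] by metis
  show ?thesis
  proof (rule bounded_familyI[where C="C * D"])
    fix i
    show "f i * g i \<in> icarrier i" using C(2) D(1) by (rule mult_carrier_mat)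
    show "inorm i (f i * g i) \<le> C * D"
      using inorm_mult[OF C(2) D(1), of i] mult_mono[OF C(3) D(2) C(1) inorm_nonneg[OF D(1)]] by (rule order_trans)
  qed
qed

lemma bounded_family_star:
  assumes "bounded_family f" shows "bounded_family (\<lambda>i. mat_star (f i))"
  using assms by (auto simp: bounded_family_def inorm_star)

typedef (overloaded) 'a mat_family = "{f :: 'a::cstar_algebra cstar_index \<Rightarrow> 'a mat. bounded_family f}"
  using bounded_family_zero by blast

setup_lifting type_definition_mat_family

definition family_norm :: "('a::cstar_algebra cstar_index \<Rightarrow> 'a mat) \<Rightarrow> real" where
  "family_norm f = (SUP i. inorm i (f i))"

lemma inorm_le_family_norm: "bounded_family f \<Longrightarrow> inorm i (f i) \<le> family_norm f"
  unfolding family_norm_def by (rule cSUP_upper) (auto simp: bounded_family_def bdd_above_def)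

lemma family_norm_le: "(\<And>i. inorm i (f i) \<le> C) \<Longrightarrow> family_norm f \<le> C"
  unfolding family_norm_def by (rule cSUP_least) auto

lemma family_norm_nonneg: "bounded_family f \<Longrightarrow> 0 \<le> family_norm f"
  using inorm_le_family_norm[of f undefined] inorm_nonneg[OF bounded_family_carrier] order_trans by blast

lemma family_norm_add:
  assumes "bounded_family f" "bounded_family g"
  shows "family_norm (\<lambda>i. f i + g i) \<le> family_norm f + family_norm g"
  by (rule family_norm_le) (intro order_trans[OF inorm_add] add_mono inorm_le_family_norm bounded_family_carrier assms)

lemma family_norm_mult:
  assumes "bounded_family f" "bounded_family g"
  shows "family_norm (\<lambda>i. f i * g i) \<le> family_norm f * family_norm g"
  by (rule family_norm_le)
    (intro order_trans[OF inorm_mult] mult_mono inorm_le_family_norm bounded_family_carrier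
      inorm_nonneg family_norm_nonneg assms)

lemma family_norm_cscale:
  assumes "bounded_family f"
  shows "family_norm (\<lambda>i. mat_cscale c (f i)) = cmod c * family_norm f"
proof (rule antisym)
  have le: "family_norm (\<lambda>i. mat_cscale c (f i)) \<le> cmod c * family_norm f" if "bounded_family f"
    for c and f :: "'a cstar_index \<Rightarrow> 'a mat"
    by (rule family_norm_le)
      (simp add: inorm_cscale bounded_family_carrier mult_left_mono inorm_le_family_norm that)
  show "family_norm (\<lambda>i. mat_cscale c (f i)) \<le> cmod c * family_norm f" using le[OF assms] .
  show "cmod c * family_norm f \<le> family_norm (\<lambda>i. mat_cscale c (f i))"
  proof (cases "c = 0")
    case True
    then show ?thesis using family_norm_nonneg[OF bounded_family_cscale[OF assms]] by simp
  next
    case False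
    have "family_norm f \<le> cmod (inverse c) * family_norm (\<lambda>i. mat_cscale c (f i))"
      using le[OF bounded_family_cscale[OF assms], of "inverse c" c] False
      by (simp add: mat_cscale_cscale mat_cscale_one)
    then show ?thesis using False by (simp add: norm_inverse norm_divide field_simps)
  qed
qed

lemma family_norm_eq_0:
  assumes "bounded_family f"
  shows "family_norm f = 0 \<longleftrightarrow> f = (\<lambda>i. 0\<^sub>m (idim i) (idim i))"
proof
  assume 0: "family_norm f = 0"
  have "inorm i (f i) = 0" for i
    using inorm_le_family_norm[OF assms, of i] inorm_nonneg[OF bounded_family_carrier[OF assms], of i] 0 by simp
  then show "f = (\<lambda>i. 0\<^sub>m (idim i) (idim i))"
    using inorm_eq_0[OF bounded_family_carrier[OF assms]] by auto
qed (simp add: family_norm_def inorm_zero)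

lemma family_norm_star_mult:
  assumes f: "bounded_family f"
  shows "family_norm (\<lambda>i. mat_star (f i) * f i) = (family_norm f)\<^sup>2"
proof (rule antisym)
  have eq: "inorm i (mat_star (f i) * f i) = (inorm i (f i))\<^sup>2" for i
    by (rule inorm_cstar[OF bounded_family_carrier[OF f]])
  show "family_norm (\<lambda>i. mat_star (f i) * f i) \<le> (family_norm f)\<^sup>2"
    by (rule family_norm_le)
      (simp add: eq power_mono inorm_le_family_norm[OF f] inorm_nonneg[OF bounded_family_carrier[OF f]])
  let ?s = "family_norm (\<lambda>i. mat_star (f i) * f i)"
  have b: "bounded_family (\<lambda>i. mat_star (f i) * f i)"
    by (intro bounded_family_mult bounded_family_star f)
  have "family_norm f \<le> sqrt ?s"
  proof (rule family_norm_le)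
    fix i
    have "(inorm i (f i))\<^sup>2 \<le> ?s" using inorm_le_family_norm[OF b, of i] by (simp add: eq)
    then show "inorm i (f i) \<le> sqrt ?s" by (rule real_le_rsqrt)
  qed
  then have "(family_norm f)\<^sup>2 \<le> (sqrt ?s)\<^sup>2" using family_norm_nonneg[OF f] by (rule power_mono)
  then show "(family_norm f)\<^sup>2 \<le> ?s" using family_norm_nonneg[OF b] by simp
qed

text \<open>
  The entrywise limits form the limit family.  Its boundedness and the uniform convergence
  both come from letting $l$ tend to infinity in the Cauchy estimate.
\<close>

lemma family_norm_complete:
  assumes X: "\<And>k. bounded_family (X k)"
    and cauchy: "\<And>\<epsilon>. \<epsilon> > 0 \<Longrightarrow> \<exists>K. \<forall>k\<ge>K. \<forall>l\<ge>K. family_norm (\<lambda>i. X k i - X l i) < \<epsilon>"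
  shows "\<exists>f. bounded_family f \<and> (\<lambda>k. family_norm (\<lambda>i. X k i - f i)) \<longlonglongrightarrow> 0"
proof -
  have carr: "X k i \<in> icarrier i" for k i using X by (rule bounded_family_carrier)
  have pointwise: "inorm i (X k i - X l i) \<le> family_norm (\<lambda>i. X k i - X l i)" for i k l
    using inorm_le_family_norm[OF bounded_family_diff[OF X X]] .
  have "\<exists>x\<in>icarrier i. (\<lambda>k. inorm i (X k i - x)) \<longlonglongrightarrow> 0" for i
  proof (rule inorm_complete)
    fix \<epsilon> :: real assume "\<epsilon> > 0"
    from cauchy[OF this] show "\<exists>K. \<forall>k\<ge>K. \<forall>l\<ge>K. inorm i (X k i - X l i) < \<epsilon>"
      using pointwise by (meson le_less_trans)
  qed (rule carr)
  then obtain f where f: "\<And>i. f i \<in> icarrier i" and lim: "\<And>i. (\<lambda>k. inorm i (X k i - f i)) \<longlonglongrightarrow> 0"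
    by metis
  have tail: "inorm i (X k i - f i) \<le> \<epsilon>"
    if K: "\<forall>k\<ge>K. \<forall>l\<ge>K. family_norm (\<lambda>i. X k i - X l i) < \<epsilon>" and k: "k \<ge> K" for \<epsilon> K k i
  proof (rule LIMSEQ_le_const)
    have "(\<lambda>l. \<epsilon> + inorm i (X l i - f i)) \<longlonglongrightarrow> \<epsilon> + 0" by (intro tendsto_add tendsto_const lim)
    then show "(\<lambda>l. \<epsilon> + inorm i (X l i - f i)) \<longlonglongrightarrow> \<epsilon>" by simp
    have "inorm i (X k i - f i) \<le> \<epsilon> + inorm i (X l i - f i)" if "l \<ge> K" for l
    proof -
      have "X k i - f i = (X k i - X l i) + (X l i - f i)"
        using carr[of k i] carr[of l i] f[of i] by (intro eq_matI) auto
      then have "inorm i (X k i - f i) \<le> inorm i (X k i - X l i) + inorm i (X l i - f i)"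
        using carr[of k i] carr[of l i] f[of i] by (metis inorm_add minus_carrier_mat)
      also have "inorm i (X k i - X l i) \<le> \<epsilon>" using pointwise[of i k l] K k that by fastforce
      finally show ?thesis by simp
    qed
    then show "\<exists>n. \<forall>l\<ge>n. inorm i (X k i - f i) \<le> \<epsilon> + inorm i (X l i - f i)" by blast
  qed
  have "bounded_family f"
  proof -
    obtain K where K: "\<forall>k\<ge>K. \<forall>l\<ge>K. family_norm (\<lambda>i. X k i - X l i) < 1" using cauchy[of 1] by auto
    show ?thesis
    proof (rule bounded_familyI[OF f, where C="family_norm (X K) + 1"])
      fix i
      have "f i = X K i - (X K i - f i)"
        using carr[of K i] f[of i] by (intro eq_matI) auto
      then have "inorm i (f i) \<le> inorm i (X K i) + inorm i (X K i - f i)"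
        using carr[of K i] f[of i] by (metis inorm_diff minus_carrier_mat)
      also have "\<dots> \<le> family_norm (X K) + 1"
        using tail[OF K order_refl] by (intro add_mono inorm_le_family_norm X)
      finally show "inorm i (f i) \<le> family_norm (X K) + 1" .
    qed
  qed
  moreover have "(\<lambda>k. family_norm (\<lambda>i. X k i - f i)) \<longlonglongrightarrow> 0"
  proof (rule LIMSEQ_I)
    fix r :: real assume "r > 0"
    then obtain K where K: "\<forall>k\<ge>K. \<forall>l\<ge>K. family_norm (\<lambda>i. X k i - X l i) < r / 2"
      using cauchy[of "r / 2"] by auto
    have "norm (family_norm (\<lambda>i. X k i - f i) - 0) < r" if "k \<ge> K" for k
    proof -
      have "family_norm (\<lambda>i. X k i - f i) \<le> r / 2"
        by (rule family_norm_le) (rule tail[OF K that])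
      moreover have "0 \<le> family_norm (\<lambda>i. X k i - f i)"
        by (intro family_norm_nonneg bounded_family_diff X \<open>bounded_family f\<close>)
      ultimately show ?thesis using \<open>r > 0\<close> by simp
    qed
    then show "\<exists>K. \<forall>k\<ge>K. norm (family_norm (\<lambda>i. X k i - f i) - 0) < r" by blast
  qed
  ultimately show ?thesis by blast
qed

instantiation mat_family :: (cstar_algebra) real_normed_algebra
begin

lift_definition zero_mat_family :: "'a mat_family" is "\<lambda>i. 0\<^sub>m (idim i) (idim i)"
  by (rule bounded_family_zero)
lift_definition plus_mat_family :: "'a mat_family \<Rightarrow> 'a mat_family \<Rightarrow> 'a mat_family" is "\<lambda>f g i. f i + g i"
  by (rule bounded_family_add)
lift_definition minus_mat_family :: "'a mat_family \<Rightarrow> 'a mat_family \<Rightarrow> 'a mat_family" is "\<lambda>f g i. f i - g i"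
  by (rule bounded_family_diff)
lift_definition uminus_mat_family :: "'a mat_family \<Rightarrow> 'a mat_family" is "\<lambda>f i. - f i"
  by (rule bounded_family_minus)
lift_definition times_mat_family :: "'a mat_family \<Rightarrow> 'a mat_family \<Rightarrow> 'a mat_family" is "\<lambda>f g i. f i * g i"
  by (rule bounded_family_mult)
lift_definition scaleR_mat_family :: "real \<Rightarrow> 'a mat_family \<Rightarrow> 'a mat_family"
  is "\<lambda>r f i. mat_cscale (complex_of_real r) (f i)"
  by (rule bounded_family_cscale)
lift_definition norm_mat_family :: "'a mat_family \<Rightarrow> real" is family_norm .
definition dist_mat_family :: "'a mat_family \<Rightarrow> 'a mat_family \<Rightarrow> real" where
  "dist_mat_family a b = norm (a - b)"
definition uniformity_mat_family :: "('a mat_family \<times> 'a mat_family) filter" where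
  "uniformity_mat_family = (INF e\<in>{0 <..}. principal {(x, y). dist x y < e})"
definition open_mat_family :: "'a mat_family set \<Rightarrow> bool" where
  "open_mat_family S = (\<forall>x\<in>S. \<forall>\<^sub>F (x', y) in uniformity. x' = x \<longrightarrow> y \<in> S)"
definition sgn_mat_family :: "'a mat_family \<Rightarrow> 'a mat_family" where
  "sgn_mat_family x = scaleR (inverse (norm x)) x"

instance
proof
  fix a b c :: "'a mat_family" and r s :: real
  show "a + b + c = a + (b + c)"
    by (transfer, rule ext, rule assoc_add_mat) (rule bounded_family_carrier, assumption)+
  show "a + b = b + a"
    by (transfer, rule ext, rule comm_add_mat) (rule bounded_family_carrier, assumption)+
  show "0 + a = a"
    by (transfer, rule ext, rule left_add_zero_mat) (rule bounded_family_carrier)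
  show "- a + a = 0"
    by (transfer, rule ext, rule uminus_l_inv_mat) (rule bounded_family_carrier)
  show "a - b = a + - b"
    by (transfer, rule ext, rule minus_add_uminus_mat) (rule bounded_family_carrier, assumption)+
  show "r *\<^sub>R (a + b) = r *\<^sub>R a + r *\<^sub>R b"
    by (transfer, rule ext, rule mat_cscale_add) (rule bounded_family_carrier, assumption)+
  show "(r + s) *\<^sub>R a = r *\<^sub>R a + s *\<^sub>R a" "r *\<^sub>R s *\<^sub>R a = (r * s) *\<^sub>R a" "1 *\<^sub>R a = a"
    by (transfer, rule ext, simp add: mat_cscale_add_left mat_cscale_cscale mat_cscale_one)+
  show "a * b * c = a * (b * c)"
    by (transfer, rule ext, rule assoc_mult_mat) (rule bounded_family_carrier, assumption)+
  show "(a + b) * c = a * c + b * c"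
    by (transfer, rule ext, rule add_mult_distrib_mat) (rule bounded_family_carrier, assumption)+
  show "a * (b + c) = a * b + a * c"
    by (transfer, rule ext, rule mult_add_distrib_mat) (rule bounded_family_carrier, assumption)+
  show "r *\<^sub>R a * b = r *\<^sub>R (a * b)"
    by (transfer, rule ext, rule mat_cscale_mult_left) (rule bounded_family_carrier, assumption)+
  show "a * r *\<^sub>R b = r *\<^sub>R (a * b)"
    by (transfer, rule ext, rule mat_cscale_mult_right) (rule bounded_family_carrier, assumption)+
  show "dist a b = norm (a - b)" by (rule dist_mat_family_def)
  show "sgn a = inverse (norm a) *\<^sub>R a" by (rule sgn_mat_family_def)
  show "uniformity = (INF e\<in>{0 <..}. principal {(x, y::'a mat_family). dist x y < e})"
    by (rule uniformity_mat_family_def)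
  show "open U = (\<forall>x\<in>U. \<forall>\<^sub>F (x', y) in uniformity. x' = x \<longrightarrow> y \<in> U)" for U :: "'a mat_family set"
    by (rule open_mat_family_def)
  show "norm (a + b) \<le> norm a + norm b" by transfer (rule family_norm_add)
  show "norm a = 0 \<longleftrightarrow> a = 0" by transfer (rule family_norm_eq_0)
  show "norm (r *\<^sub>R a) = \<bar>r\<bar> * norm a" by transfer (simp add: family_norm_cscale)
  show "norm (a * b) \<le> norm a * norm b" by transfer (rule family_norm_mult)
qed

end

instance mat_family :: (cstar_algebra) banach
proof
  fix X :: "nat \<Rightarrow> 'a mat_family"
  assume X: "Cauchy X"
  have "\<exists>f. bounded_family f \<and> (\<lambda>k. family_norm (\<lambda>i. Rep_mat_family (X k) i - f i)) \<longlonglongrightarrow> 0"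
  proof (rule family_norm_complete)
    show "bounded_family (Rep_mat_family (X k))" for k using Rep_mat_family by blast
    fix \<epsilon> :: real assume "\<epsilon> > 0"
    with X show "\<exists>K. \<forall>k\<ge>K. \<forall>l\<ge>K. family_norm (\<lambda>i. Rep_mat_family (X k) i - Rep_mat_family (X l) i) < \<epsilon>"
      by (simp add: Cauchy_iff norm_mat_family.rep_eq minus_mat_family.rep_eq)
  qed
  then obtain f where f: "bounded_family f"
    and lim: "(\<lambda>k. family_norm (\<lambda>i. Rep_mat_family (X k) i - f i)) \<longlonglongrightarrow> 0" by blast
  have "norm (X k - Abs_mat_family f) = family_norm (\<lambda>i. Rep_mat_family (X k) i - f i)" for k
    using f by (simp add: norm_mat_family.rep_eq minus_mat_family.rep_eq Abs_mat_family_inverse)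
  with lim have "(\<lambda>k. norm (X k - Abs_mat_family f)) \<longlonglongrightarrow> 0" by simp
  then have "X \<longlonglongrightarrow> Abs_mat_family f" by (simp only: tendsto_norm_zero_iff LIM_zero_iff)
  then show "convergent X" by (rule convergentI)
qed

instantiation mat_family :: (cstar_algebra) cstar_algebra
begin

lift_definition cscale_mat_family :: "complex \<Rightarrow> 'a mat_family \<Rightarrow> 'a mat_family"
  is "\<lambda>c f i. mat_cscale c (f i)"
  by (rule bounded_family_cscale)
lift_definition star_mat_family :: "'a mat_family \<Rightarrow> 'a mat_family" is "\<lambda>f i. mat_star (f i)"
  by (rule bounded_family_star)

instance
proof
  fix a b :: "'a mat_family" and r :: real and c d :: complex
  show "cscale c (a + b) = cscale c a + cscale c b"
    by (transfer, rule ext, rule mat_cscale_add) (rule bounded_family_carrier, assumption)+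
  show "cscale (c + d) a = cscale c a + cscale d a" "cscale c (cscale d a) = cscale (c * d) a"
    "cscale (complex_of_real r) a = r *\<^sub>R a"
    by (transfer, rule ext, simp add: mat_cscale_add_left mat_cscale_cscale)+
  show "cscale c a * b = cscale c (a * b)"
    by (transfer, rule ext, rule mat_cscale_mult_left) (rule bounded_family_carrier, assumption)+
  show "a * cscale c b = cscale c (a * b)"
    by (transfer, rule ext, rule mat_cscale_mult_right) (rule bounded_family_carrier, assumption)+
  show "norm (cscale c a) = cmod c * norm a" by transfer (rule family_norm_cscale)
  show "star (star a) = a" by transfer simp
  show "star (a + b) = star a + star b"
    by (transfer, rule ext, rule mat_star_add) (rule bounded_family_carrier, assumption)+
  show "star (cscale c a) = cscale (cnj c) (star a)" by transfer (simp add: mat_star_cscale)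
  show "star (a * b) = star b * star a"
    by (transfer, rule ext, rule mat_star_mult) (rule bounded_family_carrier, assumption)+
  show "norm (star a * a) = (norm a)\<^sup>2" by transfer (rule family_norm_star_mult)
qed

end

section \<open>Uniqueness of the matrix norm\<close>

definition component :: "'a::cstar_algebra mat_family \<Rightarrow> 'a cstar_index \<Rightarrow> 'a mat" where
  "component f i = Rep_mat_family f i"

text \<open>
  Matrices of the wrong size are sent to 0, so that \<open>embed\<close> is total.
\<close>

lift_definition embed :: "'a::cstar_algebra cstar_index \<Rightarrow> 'a mat \<Rightarrow> 'a mat_family"
  is "\<lambda>i x j. if j = i \<and> x \<in> icarrier i then x else 0\<^sub>m (idim j) (idim j)"
proof -
  fix i :: "'a cstar_index" and x
  show "bounded_family (\<lambda>j. if j = i \<and> x \<in> icarrier i then x else 0\<^sub>m (idim j) (idim j))"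
    by (rule bounded_familyI[where C="max 0 (inorm i x)"]) (auto simp: inorm_zero)
qed

lemma component_carrier: "component f i \<in> icarrier i"
  using Rep_mat_family[of f] by (simp add: component_def bounded_family_carrier)

lemma component_simps:
  "component (f + g) i = component f i + component g i"
  "component (f * g) i = component f i * component g i"
  "component (star f) i = mat_star (component f i)"
  by (simp_all add: component_def plus_mat_family.rep_eq times_mat_family.rep_eq star_mat_family.rep_eq)

lemma component_embed: "x \<in> icarrier i \<Longrightarrow> component (embed i x) i = x"
  by (simp add: component_def embed.rep_eq)

lemma zero_add_zero_mat: "0\<^sub>m n n + 0\<^sub>m n n = (0\<^sub>m n n :: 'a::cstar_algebra mat)"
  by (rule eq_matI) auto

lemma mat_cscale_0m: "mat_cscale c (0\<^sub>m n n) = (0\<^sub>m n n :: 'a::cstar_algebra mat)"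
  by (rule eq_matI) (auto simp: mat_cscale_def)

lemma mat_star_0m: "mat_star (0\<^sub>m n n) = (0\<^sub>m n n :: 'a::cstar_algebra mat)"
  by (rule eq_matI) (auto simp: mat_star_def)

lemma embed_add: "x \<in> icarrier i \<Longrightarrow> y \<in> icarrier i \<Longrightarrow> embed i (x + y) = embed i x + embed i y"
  by transfer (auto simp: zero_add_zero_mat)

lemma embed_mult: "x \<in> icarrier i \<Longrightarrow> y \<in> icarrier i \<Longrightarrow> embed i (x * y) = embed i x * embed i y"
  by transfer (auto simp: fun_eq_iff)

lemma embed_star: "x \<in> icarrier i \<Longrightarrow> embed i (mat_star x) = star (embed i x)"
  by transfer (auto simp: mat_star_0m)

lemma embed_cscale: "x \<in> icarrier i \<Longrightarrow> embed i (mat_cscale c x) = cscale c (embed i x)"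
  by transfer (auto simp: mat_cscale_0m)

lemma norm_embed:
  assumes x: "x \<in> icarrier i" shows "norm (embed i x) = inorm i x"
proof (rule antisym)
  show "norm (embed i x) \<le> inorm i x"
    unfolding norm_mat_family.rep_eq
    by (rule family_norm_le) (use x inorm_nonneg[OF x] in \<open>auto simp: embed.rep_eq inorm_zero\<close>)
  have "inorm i (component (embed i x) i) \<le> norm (embed i x)"
    using Rep_mat_family[of "embed i x"]
    by (simp add: component_def norm_mat_family.rep_eq inorm_le_family_norm)
  then show "inorm i x \<le> norm (embed i x)" by (simp add: component_embed x)
qed

text \<open>
  The hypotheses say that $(1 - m)^2 + h^2 = 1$, so that $1 - m + i h$ is unitary in the multiplier
  algebra.
\<close>

lemma norm_le_1_of_quasi_unitary:
  fixes h m :: "'a::cstar_algebra"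
  assumes "star h = h" "star m = m" "h * m = m * h" "2 *\<^sub>R m = h * h + m * m"
  shows "norm h \<le> 1"
proof -
  define H M where "H = left_mult h" and "M = left_mult m"
  have "norm H \<le> 1"
  proof (rule norm_le_of_squares[where k="1 - M"])
    show "star H = H" "star (1 - M) = 1 - M"
      using assms by (simp_all add: H_def M_def star_diff flip: left_mult_star)
    have "H * M = M * H" using assms(3) by (simp add: H_def M_def flip: left_mult_mult)
    then show "H * (1 - M) = (1 - M) * H" by (simp add: algebra_simps)
    have "2 *\<^sub>R M = H * H + M * M"
      using assms(4) by (simp add: H_def M_def flip: left_mult_mult left_mult_add left_mult_scaleR)
    then have "H * H = 2 *\<^sub>R M - M * M" by simp
    then show "H * H + (1 - M) * (1 - M) = 1\<^sup>2 *\<^sub>R 1"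
      by (simp add: algebra_simps scaleR_2)
  qed simp
  then show ?thesis by (simp add: H_def norm_left_mult)
qed

text \<open>
  A bound on the first norm yields a solution $m$ of $2 m = x^2 + m^2$.  The equation mentions no norm,
  so it bounds the second norm as well.
\<close>

lemma mat_cstar_norm_transfer_le_1:
  fixes x :: "'a::cstar_algebra mat"
  assumes N1: "mat_cstar_norm n N1" and N2: "mat_cstar_norm n N2"
    and x: "x \<in> carrier_mat n n" "mat_star x = x" and lt: "N1 x < 1"
  shows "N2 x \<le> 1"
proof -
  obtain i where i: "idim i = n" "inorm i = N1" using cstar_index_exists[OF N1] .
  obtain j where j: "idim j = n" "inorm j = N2" using cstar_index_exists[OF N2] .
  define h where "h = embed i x"
  have sh: "star h = h" using x i by (simp add: h_def flip: embed_star)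
  have nh: "norm h < 1" using x i lt by (simp add: h_def norm_embed)
  have "star (h * h) = h * h" by (simp add: star_mult sh)
  moreover have "norm (h * h) < 1"
    using nh by (simp add: norm_square_selfadj[OF sh] power_less_one_iff)
  ultimately obtain m where m: "star m = m" "2 *\<^sub>R m = h * h + m * m"
      "\<forall>y. y * (h * h) = (h * h) * y \<longrightarrow> y * m = m * y"
    using sqrt_one_minus by blast
  define y where "y = component m i"
  have y: "y \<in> carrier_mat n n" using component_carrier[of m i] i by (simp add: y_def)
  have hx: "component h i = x" using x i by (simp add: h_def component_embed)
  have sy: "mat_star y = y" using m(1) by (metis component_simps(3) y_def)
  have "m + m = h * h + m * m" using m(2) by (simp add: scaleR_2)
  then have yy: "y + y = x * x + y * y"
    by (metis component_simps(1,2) hx y_def)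
  have "h * m = m * h" using m(3) by (simp add: mult.assoc)
  then have xy: "x * y = y * x" by (metis component_simps(2) hx y_def)
  have "norm (embed j x) \<le> 1"
  proof (rule norm_le_1_of_quasi_unitary)
    show "star (embed j x) = embed j x" "star (embed j y) = embed j y"
      using x y j sy by (simp_all flip: embed_star)
    show "embed j x * embed j y = embed j y * embed j x"
      using x y j xy by (simp flip: embed_mult)
    have "embed j y + embed j y = embed j (x * x + y * y)"
      using y j by (simp flip: embed_add yy)
    also have "\<dots> = embed j x * embed j x + embed j y * embed j y"
      using x y j by (simp add: embed_add embed_mult)
    finally show "2 *\<^sub>R embed j y = embed j x * embed j x + embed j y * embed j y" by (simp add: scaleR_2)
  qed
  then show ?thesis using x j by (simp add: norm_embed)
qed

lemma mat_cstar_norm_le_any: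
  fixes x :: "'a::cstar_algebra mat"
  assumes N1: "mat_cstar_norm n N1" and N2: "mat_cstar_norm n N2" and x: "x \<in> carrier_mat n n"
  shows "N2 x \<le> N1 x"
proof -
  have sa: "N2 h \<le> N1 h" if h: "h \<in> carrier_mat n n" "mat_star h = h" for h
  proof (rule dense_ge)
    fix t assume t: "N1 h < t"
    then have t0: "t > 0" using cstar_norm_nonneg[OF N1 h(1)] by linarith
    define k where "k = mat_cscale (complex_of_real (1 / t)) h"
    have k: "k \<in> carrier_mat n n" "mat_star k = k" using h by (simp_all add: k_def mat_star_cscale)
    have "N1 k < 1" using t t0 h by (simp add: k_def cstar_norm_cscale[OF N1] norm_divide)
    then have "N2 k \<le> 1" using mat_cstar_norm_transfer_le_1[OF N1 N2 k] by simp
    then show "N2 h \<le> t" using t0 h by (simp add: k_def cstar_norm_cscale[OF N2] norm_divide)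
  qed
  have "mat_star (mat_star x * x) = mat_star x * x"
    using mat_star_mult[of "mat_star x" n n x n] x by simp
  then have "N2 (mat_star x * x) \<le> N1 (mat_star x * x)"
    using x by (intro sa) (auto intro: mult_carrier_mat[of _ n n])
  then have "(N2 x)\<^sup>2 \<le> (N1 x)\<^sup>2" using x by (simp add: cstar_norm_cstar[OF N1] cstar_norm_cstar[OF N2])
  then show ?thesis using cstar_norm_nonneg[OF N1 x] by (rule power2_le_imp_le)
qed

text \<open>
  Two C*-norms dominate each other, hence agree; so the description in the definition of \<open>mat_norm\<close>
  denotes the given norm.
\<close>

theorem mat_norm_eq:
  assumes N: "mat_cstar_norm n N" and x: "x \<in> carrier_mat n n"
  shows "mat_norm n x = N x"
  unfolding mat_norm_def
proof (rule the_equality)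
  fix r assume "\<exists>N. mat_cstar_norm n N \<and> r = N x"
  then obtain N' where N': "mat_cstar_norm n N'" "r = N' x" by blast
  show "r = N x" using mat_cstar_norm_le_any[OF N N'(1) x] mat_cstar_norm_le_any[OF N'(1) N x] N'(2) by simp
qed (use N in blast)

section \<open>Functionals on matrices over a star-subspace\<close>

lemma mats_carrier: "x \<in> mats n V \<Longrightarrow> x \<in> carrier_mat n n"
  by (simp add: mats_def)

lemma mats_closed:
  assumes "star_subspace V"
  shows "0\<^sub>m n n \<in> mats n V" "x \<in> mats n V \<Longrightarrow> y \<in> mats n V \<Longrightarrow> x + y \<in> mats n V"
    "x \<in> mats n V \<Longrightarrow> mat_cscale c x \<in> mats n V" "x \<in> mats n V \<Longrightarrow> mat_star x \<in> mats n V"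
  using assms by (auto simp: mats_def star_subspace_def mat_cscale_def mat_star_def)

text \<open>
  With $t e_\lambda = d^* d$ the block matrix is $Y^* Y$ for the diagonal matrix $Y$ with entries $d$.
\<close>

lemma zero_block_in_mats_pos:
  assumes aou: "approx_order_unit V L lle e" and V: "star_subspace V"
    and l: "l \<in> L" and t: "t > 0"
  shows "four_block_mat (diag_const n (t *\<^sub>R e l)) (0\<^sub>m n n) (mat_star (0\<^sub>m n n)) (diag_const n (t *\<^sub>R e l))
    \<in> mats_pos (2 * n) V"
proof -
  have el: "e l \<in> V" "positive (e l)" using aou l by (auto simp: approx_order_unit_def)
  then obtain b where b: "e l = star b * b" by (auto simp: positive_def)
  define x where "x = t *\<^sub>R e l"
  have xV: "x \<in> V" and V0: "0 \<in> V"
    using V el by (auto simp: star_subspace_def x_def simp flip: cscale_of_real)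
  define d where "d = sqrt t *\<^sub>R b"
  have dd: "star d * d = x" using t b by (simp add: d_def x_def)
  have block: "four_block_mat (diag_const n x) (0\<^sub>m n n) (mat_star (0\<^sub>m n n)) (diag_const n x) = diag_const (2 * n) x"
    by (rule eq_matI) (auto simp: diag_const_def mat_star_def)
  have sum: "(\<Sum>k = 0..<2 * n. star (if k = i then d else 0) * (if k = j then d else 0))
      = (if i = j then star d * d else 0)" if "i < 2 * n" for i j
  proof -
    have "(\<Sum>k = 0..<2 * n. star (if k = i then d else 0) * (if k = j then d else 0))
        = (\<Sum>k = 0..<2 * n. if k = i then (if i = j then star d * d else 0) else 0)"
      by (rule sum.cong) auto
    then show ?thesis using that by simp
  qed
  have "mat_star (diag_const (2 * n) d) * diag_const (2 * n) d = diag_const (2 * n) (star d * d)"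
    by (rule eq_matI) (simp_all add: diag_const_def mat_star_def scalar_prod_def sum)
  then have "diag_const (2 * n) x = mat_star (diag_const (2 * n) d) * diag_const (2 * n) d" by (simp add: dd)
  moreover have "diag_const (2 * n) d \<in> carrier_mat (2 * n) (2 * n)" by (simp add: diag_const_def)
  moreover have "diag_const (2 * n) x \<in> mats (2 * n) V" using xV V0 by (auto simp: mats_def diag_const_def)
  ultimately show ?thesis unfolding mats_pos_def x_def[symmetric] block by blast
qed

text \<open>
  By the preceding lemma the infimum in \<open>norm_defining\<close> runs over all $t > 0$.  The value follows for
  \<open>mat_norm\<close> as defined, whether or not a C*-norm exists.
\<close>

lemma mat_norm_zero:
  fixes V :: "'a::cstar_algebra set"
  assumes V: "star_subspace V" and aou: "approx_order_unit V L lle e"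
    and nd: "norm_defining V L e" and n: "n \<ge> 1"
  shows "mat_norm n (0\<^sub>m n n :: 'a::cstar_algebra mat) = 0" (is "mat_norm n ?Z = 0")
proof -
  obtain l where l: "l \<in> L" using aou by (auto simp: approx_order_unit_def directed_index_def)
  let ?T = "{t. 0 < t \<and> (\<exists>l\<in>L. four_block_mat (diag_const n (t *\<^sub>R e l)) ?Z (mat_star ?Z) (diag_const n (t *\<^sub>R e l)) \<in> mats_pos (2 * n) V)}"
  have T: "?T = {0<..}" using zero_block_in_mats_pos[OF aou V l] l by auto
  have "ereal (mat_norm n ?Z) = (INF t\<in>?T. ereal t)"
    using nd n mats_closed(1)[OF V] unfolding norm_defining_def by blast
  also have "\<dots> = 0"
  proof (rule antisym)
    show "(INF t\<in>?T. ereal t) \<le> 0"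
      unfolding T
    proof (rule ereal_le_epsilon2)
      fix r :: real assume "0 < r"
      then show "(INF t\<in>{0<..}. ereal t) \<le> 0 + ereal r" by (auto intro: INF_lower)
    qed
    show "0 \<le> (INF t\<in>?T. ereal t)" unfolding T by (rule INF_greatest) simp
  qed
  finally show ?thesis by simp
qed

text \<open>
  Without a C*-norm the description defining \<open>mat_norm\<close> does not depend on the matrix.
\<close>

lemma mat_norm_zero_of_no_norm:
  fixes V :: "'a::cstar_algebra set"
  assumes no: "\<nexists>N. mat_cstar_norm n (N :: 'a::cstar_algebra mat \<Rightarrow> real)"
    and V: "star_subspace V" and aou: "approx_order_unit V L lle e"
    and nd: "norm_defining V L e" and n: "n \<ge> 1"
  shows "mat_norm n (x :: 'a mat) = 0"
proof -
  have "mat_norm n x = mat_norm n (0\<^sub>m n n :: 'a mat)" using no by (simp add: mat_norm_def)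
  then show ?thesis using mat_norm_zero[OF V aou nd n] by simp
qed

lemma mats_linear_zero:
  assumes lin: "mats_linear n E \<phi>" and E: "star_subspace E"
  shows "\<phi> (0\<^sub>m n n) = 0"
proof -
  have "\<phi> (mat_cscale 0 (0\<^sub>m n n)) = 0 * \<phi> (0\<^sub>m n n)"
    using lin mats_closed(1)[OF E, of n] unfolding mats_linear_def by blast
  then show ?thesis by (simp add: mat_cscale_0m)
qed

lemma mats_linear_bounded:
  fixes E :: "'a::cstar_algebra set" and N :: "'a mat \<Rightarrow> real" and \<phi> :: "'a mat \<Rightarrow> complex"
  assumes N: "mat_cstar_norm n N" and E: "star_subspace E"
    and lin: "mats_linear n E \<phi>" and cont: "mats_continuous n E \<phi>"
  obtains D where "D \<ge> 0" "dual_norm n E \<phi> = ereal D" "\<And>x. x \<in> mats n E \<Longrightarrow> cmod (\<phi> x) \<le> D * N x"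
proof -
  have phi0: "\<phi> (0\<^sub>m n n) = 0" by (rule mats_linear_zero[OF lin E])
  have Z: "0\<^sub>m n n \<in> mats n E" by (rule mats_closed[OF E])
  have sc: "\<phi> (mat_cscale c x) = c * \<phi> x" if "x \<in> mats n E" for c x
    using lin that by (simp add: mats_linear_def)
  obtain \<delta> where \<delta>: "\<delta> > 0" "\<And>y. y \<in> mats n E \<Longrightarrow> mat_norm n (y - 0\<^sub>m n n) < \<delta> \<Longrightarrow> cmod (\<phi> y - \<phi> (0\<^sub>m n n)) < 1"
    using cont[unfolded mats_continuous_def, THEN bspec, OF Z, THEN spec, of 1] by auto
  have small: "cmod (\<phi> y) < 1" if y: "y \<in> mats n E" "N y < \<delta>" for y
  proof -
    have "y - 0\<^sub>m n n = y" using mats_carrier[OF y(1)] by (intro eq_matI) auto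
    then show ?thesis using \<delta>(2)[OF y(1)] y(2) phi0 mat_norm_eq[OF N mats_carrier[OF y(1)]] by simp
  qed
  have ball: "{x \<in> mats n E. mat_norm n x \<le> 1} = {x \<in> mats n E. N x \<le> 1}"
    by (auto simp: mat_norm_eq[OF N mats_carrier])
  have unit: "cmod (\<phi> x) \<le> 2 / \<delta>" if x: "x \<in> mats n E" "N x \<le> 1" for x
  proof -
    define y where "y = mat_cscale (complex_of_real (\<delta> / 2)) x"
    have "N y = \<delta> / 2 * N x"
      using \<delta>(1) cstar_norm_cscale[OF N mats_carrier[OF x(1)], of "complex_of_real (\<delta> / 2)"] by (simp add: y_def norm_divide norm_mult)
    also have "\<dots> < \<delta>" using x(2) \<delta>(1) mult_left_mono[OF x(2), of "\<delta> / 2"] by simp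
    finally have "cmod (\<phi> y) < 1" using x E by (intro small) (simp_all add: y_def mats_closed)
    then show ?thesis using \<delta>(1) x by (simp add: y_def sc norm_mult norm_divide field_simps)
  qed
  define d where "d = dual_norm n E \<phi>"
  have upper: "ereal (cmod (\<phi> x)) \<le> d" if "x \<in> mats n E" "N x \<le> 1" for x
    unfolding d_def dual_norm_def ball by (rule SUP_upper) (use that in simp)
  have "d \<le> ereal (2 / \<delta>)"
    unfolding d_def dual_norm_def ball by (rule SUP_least) (use unit in simp)
  moreover have "0 \<le> d" using upper[OF Z] cstar_norm_zero[OF N] phi0 by (simp add: zero_ereal_def)
  ultimately obtain D where D: "d = ereal D" "D \<ge> 0" by (cases d) auto
  have "cmod (\<phi> x) \<le> D * N x" if x: "x \<in> mats n E" for x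
  proof (cases "N x = 0")
    case True
    then have "x = 0\<^sub>m n n" using cstar_norm_eq_0[OF N mats_carrier[OF x]] by simp
    then show ?thesis using phi0 True by simp
  next
    case False
    then have pos: "N x > 0" using cstar_norm_nonneg[OF N mats_carrier[OF x]] by simp
    define y where "y = mat_cscale (complex_of_real (1 / N x)) x"
    have "N y = 1"
      using pos cstar_norm_cscale[OF N mats_carrier[OF x], of "complex_of_real (1 / N x)"] by (simp add: y_def norm_divide)
    moreover have "y \<in> mats n E" using x E by (simp add: y_def mats_closed)
    ultimately have "cmod (\<phi> y) \<le> D" using upper[of y] D by simp
    then show ?thesis using pos x by (simp add: y_def sc norm_mult norm_divide field_simps)
  qed
  with D that show ?thesis by (simp add: d_def)
qed

text \<open>
  The hypothesis \<open>bd\<close> has independent arguments; taking the supremum over one and then over the other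
  bounds the sum of the dual norms.
\<close>

lemma dual_norm_add_eq:
  fixes E :: "'a::cstar_algebra set"
  assumes dec: "\<And>x. x \<in> mats n E \<Longrightarrow> \<phi> x = \<phi>p x - \<phi>m x"
    and D: "dual_norm n E \<phi> = ereal D"
    and ne: "z \<in> mats n E" "mat_norm n z \<le> 1"
    and bd: "\<And>x y. x \<in> mats n E \<Longrightarrow> mat_norm n x \<le> 1 \<Longrightarrow> y \<in> mats n E \<Longrightarrow> mat_norm n y \<le> 1
      \<Longrightarrow> cmod (\<phi>p x) + cmod (\<phi>m y) \<le> D"
  shows "dual_norm n E \<phi> = dual_norm n E \<phi>p + dual_norm n E \<phi>m"
proof (rule antisym)
  define U where "U = {x \<in> mats n E. mat_norm n x \<le> 1}"
  have dn: "dual_norm n E \<psi> = (SUP x\<in>U. ereal (cmod (\<psi> x)))" for \<psi>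
    by (simp add: dual_norm_def U_def)
  show "dual_norm n E \<phi> \<le> dual_norm n E \<phi>p + dual_norm n E \<phi>m"
    unfolding dn
  proof (rule SUP_least)
    fix x assume x: "x \<in> U"
    then have "cmod (\<phi> x) \<le> cmod (\<phi>p x) + cmod (\<phi>m x)"
      using norm_triangle_ineq4[of "\<phi>p x" "\<phi>m x"] by (simp add: dec U_def)
    then have "ereal (cmod (\<phi> x)) \<le> ereal (cmod (\<phi>p x)) + ereal (cmod (\<phi>m x))" by simp
    also have "\<dots> \<le> (SUP x\<in>U. ereal (cmod (\<phi>p x))) + (SUP x\<in>U. ereal (cmod (\<phi>m x)))"
      using x by (intro add_mono SUP_upper)
    finally show "ereal (cmod (\<phi> x)) \<le> (SUP x\<in>U. ereal (cmod (\<phi>p x))) + (SUP x\<in>U. ereal (cmod (\<phi>m x)))" .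
  qed
  have z: "z \<in> U" using ne by (simp add: U_def)
  have m: "dual_norm n E \<phi>m \<le> ereal (D - cmod (\<phi>p x))" if "x \<in> U" for x
    unfolding dn by (rule SUP_least) (use bd[of x] that in \<open>auto simp: U_def algebra_simps\<close>)
  have "ereal (cmod (\<phi>m z)) \<le> dual_norm n E \<phi>m" unfolding dn by (rule SUP_upper[OF z])
  with m[OF z] obtain r where r: "dual_norm n E \<phi>m = ereal r" by (cases "dual_norm n E \<phi>m") auto
  have "dual_norm n E \<phi>p \<le> ereal (D - r)"
    unfolding dn[of \<phi>p] by (rule SUP_least) (use m r in \<open>auto simp: algebra_simps\<close>)
  then have "dual_norm n E \<phi>p + dual_norm n E \<phi>m \<le> ereal (D - r) + ereal r" unfolding r by (rule add_right_mono)
  then show "dual_norm n E \<phi>p + dual_norm n E \<phi>m \<le> dual_norm n E \<phi>" by (simp add: D)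
qed

text \<open>
  The image of \<open>mats n E\<close> under the isometric embedding is a star-subspace of a C*-algebra that is a
  type, and \<open>\<phi>\<close> is transported to it by reading off components.
\<close>

lemma jordan_decomposition_mats:
  fixes E :: "'a::cstar_algebra set" and N :: "'a mat \<Rightarrow> real" and \<phi> :: "'a mat \<Rightarrow> complex"
  assumes N: "mat_cstar_norm n N" and E: "star_subspace E"
    and lin: "mats_linear n E \<phi>" and cont: "mats_continuous n E \<phi>" and herm: "mats_hermitian n E \<phi>"
  shows "\<exists>\<phi>p \<phi>m. mats_linear n E \<phi>p \<and> mats_positive n E \<phi>p \<and>
           mats_linear n E \<phi>m \<and> mats_positive n E \<phi>m \<and>
           (\<forall>x\<in>mats n E. \<phi> x = \<phi>p x - \<phi>m x) \<and>
           dual_norm n E \<phi> = dual_norm n E \<phi>p + dual_norm n E \<phi>m"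
proof -
  obtain D where D: "D \<ge> 0" "dual_norm n E \<phi> = ereal D" "\<And>x. x \<in> mats n E \<Longrightarrow> cmod (\<phi> x) \<le> D * N x"
    using mats_linear_bounded[OF N E lin cont] by metis
  obtain i where i: "idim i = n" "inorm i = N" using cstar_index_exists[OF N] .
  define V where "V = embed i ` mats n E"
  define \<psi> where "\<psi> v = \<phi> (component v i)" for v
  have ic: "x \<in> icarrier i" if "x \<in> mats n E" for x using mats_carrier[OF that] i by simp
  have ic': "x \<in> icarrier i" if "x \<in> carrier_mat n n" for x using that i by simp
  have psi: "\<psi> (embed i x) = \<phi> x" if "x \<in> mats n E" for x
    using ic[OF that] by (simp add: \<psi>_def component_embed)
  note cl = mats_closed[OF E]
  have hom: "embed i (x + y) = embed i x + embed i y" "embed i (mat_cscale c x) = cscale c (embed i x)"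
    "embed i (mat_star x) = star (embed i x)" if "x \<in> mats n E" "y \<in> mats n E" for c x y
    using that ic by (simp_all add: embed_add embed_cscale embed_star)
  have hom0: "embed i (0\<^sub>m n n) = 0"
    using embed_cscale[OF ic[OF cl(1)], of 0] by (simp add: mat_cscale_0m)
  have VE: "embed i x \<in> V" if "x \<in> mats n E" for x using that by (simp add: V_def)
  have sV: "star_subspace V"
    unfolding star_subspace_def
  proof (intro conjI ballI allI)
    show "0 \<in> V" using VE[OF cl(1)] by (simp add: hom0)
    fix u c assume "u \<in> V"
    then obtain x where x: "x \<in> mats n E" "u = embed i x" by (auto simp: V_def)
    show "cscale c u \<in> V" "star u \<in> V"
      using VE[OF cl(3)[OF x(1), of c]] VE[OF cl(4)[OF x(1)]] hom(2,3)[OF x(1) x(1)] by (simp_all add: x(2))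
    fix v assume "v \<in> V"
    then obtain y where y: "y \<in> mats n E" "v = embed i y" by (auto simp: V_def)
    show "u + v \<in> V" using VE[OF cl(2)[OF x(1) y(1)]] hom(1)[OF x(1) y(1)] by (simp add: x(2) y(2))
  qed
  have padd: "\<psi> (u + v) = \<psi> u + \<psi> v" if uv: "u \<in> V" "v \<in> V" for u v
  proof -
    obtain x y where xy: "x \<in> mats n E" "y \<in> mats n E" "u = embed i x" "v = embed i y"
      using uv by (auto simp: V_def)
    show ?thesis
      using lin xy(1,2) psi[OF cl(2)[OF xy(1,2)]] psi[OF xy(1)] psi[OF xy(2)] hom(1)[OF xy(1,2)]
      by (simp add: xy(3,4) mats_linear_def)
  qed
  have psc: "\<psi> (cscale c u) = c * \<psi> u" if u: "u \<in> V" for c u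
  proof -
    obtain x where x: "x \<in> mats n E" "u = embed i x" using u by (auto simp: V_def)
    show ?thesis
      using lin x(1) psi[OF cl(3)[OF x(1)]] psi[OF x(1)] hom(2)[OF x(1) x(1)]
      by (simp add: x(2) mats_linear_def)
  qed
  have pherm: "\<psi> (star u) = cnj (\<psi> u)" if u: "u \<in> V" for u
  proof -
    obtain x where x: "x \<in> mats n E" "u = embed i x" using u by (auto simp: V_def)
    show ?thesis
      using herm x(1) psi[OF cl(4)[OF x(1)]] psi[OF x(1)] hom(3)[OF x(1) x(1)]
      by (simp add: x(2) mats_hermitian_def)
  qed
  have pbd: "cmod (\<psi> u) \<le> D * norm u" if u: "u \<in> V" for u
  proof -
    obtain x where x: "x \<in> mats n E" "u = embed i x" using u by (auto simp: V_def)
    show ?thesis using D(3)[OF x(1)] psi[OF x(1)] norm_embed[OF ic[OF x(1)]] by (simp add: x(2) i)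
  qed
  obtain P M where
        P: "\<And>x y. P (x + y) = P x + P y" "\<And>c x. P (cscale c x) = c * P x" "\<And>y. P (star y * y) \<in> \<real>\<^sub>\<ge>\<^sub>0"
    and M: "\<And>x y. M (x + y) = M x + M y" "\<And>c x. M (cscale c x) = c * M x" "\<And>y. M (star y * y) \<in> \<real>\<^sub>\<ge>\<^sub>0"
    and PM: "\<And>u. u \<in> V \<Longrightarrow> \<psi> u = P u - M u"
    and bd: "\<And>u v. norm u \<le> 1 \<Longrightarrow> norm v \<le> 1 \<Longrightarrow> cmod (P u) + cmod (M v) \<le> D"
    using sV padd psc pherm D(1) pbd
    by (rule jordan_decomposition_star_subspace[where V=V and \<phi>=\<psi> and D=D]) (assumption | rule that)+
  have lin': "mats_linear n E (\<lambda>x. Q (embed i x))"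
    if "\<And>x y. Q (x + y) = Q x + Q y" "\<And>c x. Q (cscale c x) = c * Q x" for Q :: "'a mat_family \<Rightarrow> complex"
    unfolding mats_linear_def using that hom by simp
  have pos': "mats_positive n E (\<lambda>x. Q (embed i x))"
    if "\<And>y. Q (star y * y) \<in> \<real>\<^sub>\<ge>\<^sub>0" for Q :: "'a mat_family \<Rightarrow> complex"
    unfolding mats_positive_def
  proof
    fix x assume "x \<in> mats_pos n E"
    then obtain y where y: "y \<in> carrier_mat n n" "x = mat_star y * y" by (auto simp: mats_pos_def)
    then have "embed i x = star (embed i y) * embed i y"
      using ic'[OF y(1)] by (simp add: embed_mult embed_star)
    then show "Q (embed i x) \<in> \<real>\<^sub>\<ge>\<^sub>0" using that by simp
  qed
  have dec: "\<phi> x = P (embed i x) - M (embed i x)" if "x \<in> mats n E" for x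
    using PM[of "embed i x"] psi[OF that] that by (simp add: V_def)
  have nrm: "norm (embed i x) = mat_norm n x" if "x \<in> mats n E" for x
    using norm_embed[OF ic[OF that]] mat_norm_eq[OF N mats_carrier[OF that]] i by simp
  have "mat_norm n (0\<^sub>m n n :: 'a mat) \<le> 1" using nrm[OF cl(1)] hom0 by simp
  then have "dual_norm n E \<phi> = dual_norm n E (\<lambda>x. P (embed i x)) + dual_norm n E (\<lambda>x. M (embed i x))"
    using bd nrm by (intro dual_norm_add_eq[OF dec D(2) cl(1)]) simp_all
  moreover have "mats_linear n E (\<lambda>x. P (embed i x))" "mats_positive n E (\<lambda>x. P (embed i x))"
    by (rule lin'[OF P(1,2)], rule pos'[of P, OF P(3)])
  moreover have "mats_linear n E (\<lambda>x. M (embed i x))" "mats_positive n E (\<lambda>x. M (embed i x))"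
    by (rule lin'[OF M(1,2)], rule pos'[of M, OF M(3)])
  ultimately show ?thesis using dec by blast
qed

theorem theorem2p15:
  fixes E EE AA :: "'a::cstar_algebra set"
    and L :: "'l set" and lle :: "'l \<Rightarrow> 'l \<Rightarrow> bool" and e :: "'l \<Rightarrow> 'a"
    and n :: nat and \<phi> :: "'a mat \<Rightarrow> complex"
  assumes "star_subspace E" and "closed E"
    and "star_subspace EE" and "star_subspace AA" and "EE \<subseteq> AA"
    and "EE \<subseteq> E" and "E \<subseteq> closure EE"
    and "closure AA = UNIV"
    and "approx_order_unit AA L lle e" and "norm_defining AA L e"
    and "\<forall>l\<in>L. e l \<in> EE"
    and "n \<ge> 1"
    and "mats_linear n E \<phi>" and "mats_continuous n E \<phi>" and "mats_hermitian n E \<phi>"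
  shows "\<exists>\<phi>p \<phi>m. mats_linear n E \<phi>p \<and> mats_positive n E \<phi>p \<and>
           mats_linear n E \<phi>m \<and> mats_positive n E \<phi>m \<and>
           (\<forall>x\<in>mats n E. \<phi> x = \<phi>p x - \<phi>m x) \<and>
           dual_norm n E \<phi> = dual_norm n E \<phi>p + dual_norm n E \<phi>m"
proof (cases "\<exists>N :: 'a mat \<Rightarrow> real. mat_cstar_norm n N")
  case True
  then obtain N :: "'a mat \<Rightarrow> real" where N: "mat_cstar_norm n N" ..
  show ?thesis by (rule jordan_decomposition_mats[OF N assms(1,13-15)])
next
  case False
  have norm0: "mat_norm n x = 0" for x :: "'a mat"
    by (rule mat_norm_zero_of_no_norm[OF False assms(4,9,10,12)])
  have Z: "0\<^sub>m n n \<in> mats n E" by (rule mats_closed[OF assms(1)])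
  have zero: "\<phi> x = 0" if x: "x \<in> mats n E" for x
  proof -
    have "cmod (\<phi> x - \<phi> (0\<^sub>m n n)) < \<epsilon>" if eps: "\<epsilon> > 0" for \<epsilon>
    proof -
      obtain \<delta> where "\<delta> > 0" "\<forall>y\<in>mats n E. mat_norm n (y - 0\<^sub>m n n) < \<delta> \<longrightarrow> cmod (\<phi> y - \<phi> (0\<^sub>m n n)) < \<epsilon>"
        using assms(14)[unfolded mats_continuous_def, THEN bspec, OF Z, THEN spec, of \<epsilon>] eps by auto
      then show ?thesis using x norm0 by auto
    qed
    then have "cmod (\<phi> x - \<phi> (0\<^sub>m n n)) = 0" by (metis less_irrefl norm_ge_zero order_le_less)
    then show ?thesis using mats_linear_zero[OF assms(13,1)] by simp
  qed
  have "mats_linear n E (\<lambda>x. 0)" "mats_positive n E (\<lambda>x. 0)"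
    by (simp_all add: mats_linear_def mats_positive_def)
  moreover have "dual_norm n E \<phi> = dual_norm n E (\<lambda>x. 0) + dual_norm n E (\<lambda>x. 0)"
  proof (rule dual_norm_add_eq[where z="0\<^sub>m n n" and D=0])
    show "dual_norm n E \<phi> = ereal 0"
      unfolding dual_norm_def using Z zero norm0 by (auto simp: zero_ereal_def intro!: antisym SUP_least SUP_upper2[OF _ order_refl])
  qed (use zero Z norm0 in auto)
  ultimately show ?thesis using zero by force
qed

end
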